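(* Let $N \ge 2$ be an integer, let $1 < p < \infty$ if $N = 2$ and $1 < p < 2^*$ if $N \ge 3$, let $1 \le q < \infty$ with $pq > 2$, and let $1 < b < b_*$. Then $E^{p,q}_{b,\mathrm{rad}}(\mathbb{R}^N)$ is not continuously embedded in $L^s(\mathbb{R}^N)$ for any $1 \le s < 2^{p,q}_{b,*}$.
   Context: $2^* = 2N/(N-2)$ for $N \ge 3$. $b_* = 1 + 2q$ if $N = 2$ and $b_* = 1 + Nq\,(1 - p/2^* )$ if $N \ge 3$. $$2^{p,q}_{b,*} = \frac{2\,[(N-1)pq + b - 1]}{2(N-1)q + 1 - b}.$$ $B_\rho = \{x \in \mathbb{R}^N : |x| < \rho\}$. For a measurable function $u : \mathbb{R}^N \to \mathbb{R}$, $h_u(\rho) = \int_{B_\rho} |u|^p\, dy$ for $\rho > 0$, and $\|u\|_{L^{p,q}_b(\mathbb{R}^N)} = \left(\int_0^\infty \rho^{-b}\, h_u^q(\rho)\, d\rho\right)^{1/pq}$. $E^{p,q}_b(\mathbb{R}^N)$ is the space of all weakly differentiable functions $u : \mathbb{R}^N \to \mathbb{R}$ such that $\|\nabla u\|_{L^2(\mathbb{R}^N)} + \|u\|_{L^{p,q}_b(\mathbb{R}^N)} < \infty$, with norm $\|u\|_{E^{p,q}_b(\mathbb{R}^N)} = \left(\|\nabla u\|_{L^2(\mathbb{R}^N)}^{2pq} + \|u\|_{L^{p,q}_b(\mathbb{R}^N)}^{2pq}\right)^{1/2pq}$. $E^{p,q}_{b,\mathrm{rad}}(\mathbb{R}^N)$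 is its subspace of radially symmetric functions. Continuous embedding in $L^s(\mathbb{R}^N)$ means that there is a constant $C > 0$ with $\|u\|_{L^s(\mathbb{R}^N)} \le C \|u\|_{E^{p,q}_b(\mathbb{R}^N)}$ for all $u \in E^{p,q}_{b,\mathrm{rad}}(\mathbb{R}^N)$. *)

theory Defs
  imports "HOL-Analysis.Analysis"
begin

(* Powers with a positive exponent on [0, \<infinity>]; in particular \<infinity> to the power a is \<infinity>. *)
definition ennpowr :: "ennreal \<Rightarrow> real \<Rightarrow> ennreal" where
  "ennpowr x a = (if x = \<infinity> then \<infinity> else ennreal (enn2real x powr a))"

section \<open>Weak derivatives\<close>

definition pdiff :: "'n \<Rightarrow> (real ^ 'n \<Rightarrow> real) \<Rightarrow> real ^ 'n \<Rightarrow> real" where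
  "pdiff i f x = frechet_derivative f (at x) (axis i 1)"

primrec C_k :: "nat \<Rightarrow> (real ^ 'n \<Rightarrow> real) \<Rightarrow> bool" where
  "C_k 0 f \<longleftrightarrow> continuous_on UNIV f"
| "C_k (Suc k) f \<longleftrightarrow> (\<forall>x. f differentiable (at x)) \<and> (\<forall>i. C_k k (pdiff i f))"

definition test_functions :: "(real ^ 'n \<Rightarrow> real) set" where
  "test_functions = {\<phi>. (\<forall>k. C_k k \<phi>) \<and> compact (closure {x. \<phi> x \<noteq> 0})}"

definition locally_integrable :: "('a::euclidean_space \<Rightarrow> 'b::euclidean_space) \<Rightarrow> bool" where
  "locally_integrable f \<longleftrightarrow> (\<forall>K. compact K \<longrightarrow> f absolutely_integrable_on K)"

definition has_weak_gradient :: "(real ^ 'n \<Rightarrow> real) \<Rightarrow> (real ^ 'n \<Rightarrow> real ^ 'n) \<Rightarrow> bool" where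
  "has_weak_gradient u g \<longleftrightarrow>
     locally_integrable u \<and> locally_integrable g \<and>
     (\<forall>\<phi>\<in>test_functions. \<forall>i.
        (LINT x|lebesgue. u x * pdiff i \<phi> x) = - (LINT x|lebesgue. g x $ i * \<phi> x))"

definition weakly_differentiable :: "(real ^ 'n \<Rightarrow> real) \<Rightarrow> bool" where
  "weakly_differentiable u \<longleftrightarrow> (\<exists>g. has_weak_gradient u g)"

(* The weak gradient is determined only almost everywhere: this picks a representative,
   and has no meaning unless u is weakly differentiable. *)
definition weak_gradient :: "(real ^ 'n \<Rightarrow> real) \<Rightarrow> real ^ 'n \<Rightarrow> real ^ 'n" where
  "weak_gradient u = (SOME g. has_weak_gradient u g)"

section \<open>Norms and spaces\<close>

(* All norms take values in [0, \<infinity>], and functions stand for their classes modulo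
   almost everywhere equality. *)
definition L_norm :: "real \<Rightarrow> ('a::euclidean_space \<Rightarrow> 'b::real_normed_vector) \<Rightarrow> ennreal" where
  "L_norm s u = ennpowr (\<integral>\<^sup>+x. ennreal (norm (u x) powr s) \<partial>lebesgue) (1 / s)"

definition ball_mass :: "real \<Rightarrow> (real ^ 'n \<Rightarrow> real) \<Rightarrow> real \<Rightarrow> ennreal" where
  "ball_mass p u \<rho> = (\<integral>\<^sup>+y\<in>ball 0 \<rho>. ennreal (\<bar>u y\<bar> powr p) \<partial>lebesgue)"

definition Lpqb_norm :: "real \<Rightarrow> real \<Rightarrow> real \<Rightarrow> (real ^ 'n \<Rightarrow> real) \<Rightarrow> ennreal" where
  "Lpqb_norm p q b u =
     ennpowr (\<integral>\<^sup>+\<rho>\<in>{0<..}. ennreal (\<rho> powr (- b)) * ennpowr (ball_mass p u \<rho>) q \<partial>lebesgue)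
       (1 / (p * q))"

definition E_space :: "real \<Rightarrow> real \<Rightarrow> real \<Rightarrow> (real ^ 'n \<Rightarrow> real) set" where
  "E_space p q b =
     {u. weakly_differentiable u \<and> L_norm 2 (weak_gradient u) + Lpqb_norm p q b u < \<infinity>}"

definition E_norm :: "real \<Rightarrow> real \<Rightarrow> real \<Rightarrow> (real ^ 'n \<Rightarrow> real) \<Rightarrow> ennreal" where
  "E_norm p q b u =
     ennpowr (ennpowr (L_norm 2 (weak_gradient u)) (2 * p * q)
              + ennpowr (Lpqb_norm p q b u) (2 * p * q))
       (1 / (2 * p * q))"

definition radially_symmetric :: "(real ^ 'n \<Rightarrow> real) \<Rightarrow> bool" where
  "radially_symmetric u \<longleftrightarrow> (\<exists>f. AE x in lebesgue. u x = f (norm x))"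

definition E_rad_space :: "real \<Rightarrow> real \<Rightarrow> real \<Rightarrow> (real ^ 'n \<Rightarrow> real) set" where
  "E_rad_space p q b = {u \<in> E_space p q b. radially_symmetric u}"

definition E_rad_embedded_in_L :: "'n::finite itself \<Rightarrow> real \<Rightarrow> real \<Rightarrow> real \<Rightarrow> real \<Rightarrow> bool" where
  "E_rad_embedded_in_L TYPE('n) p q b s \<longleftrightarrow>
     (\<exists>C>0. \<forall>u::real ^ 'n \<Rightarrow> real. u \<in> E_rad_space p q b \<longrightarrow>
        L_norm s u \<le> ennreal C * E_norm p q b u)"

section \<open>Exponents\<close>

(* Used only for N \<ge> 3. *)
definition two_star :: "nat \<Rightarrow> real" where
  "two_star N = 2 * real N / (real N - 2)"

definition b_star :: "nat \<Rightarrow> real \<Rightarrow> real \<Rightarrow> real" where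
  "b_star N p q = (if N = 2 then 1 + 2 * q else 1 + real N * q * (1 - p / two_star N))"

definition two_star_pqb :: "nat \<Rightarrow> real \<Rightarrow> real \<Rightarrow> real \<Rightarrow> real" where
  "two_star_pqb N p q b =
     2 * ((real N - 1) * p * q + b - 1) / (2 * (real N - 1) * q + 1 - b)"

end

theory Submission
  imports Defs
begin

text \<open>
  The embedding fails on bumps of height 1 that live on annuli of radius \<open>R \<rightarrow> \<infinity>\<close> and width
  \<open>w = R powr a\<close>. Such an annulus has volume of order \<open>R powr (N - 1) * w\<close>, so a bump \<open>u\<close> satisfies,
  up to constants,

    \<^item> \<open>\<parallel>u\<parallel>\<close> in \<open>L\<^sup>s\<close> is at least \<open>(R powr (N - 1) * w) powr (1 / s)\<close>;
    \<^item> \<open>\<parallel>\<nabla>u\<parallel>\<close> in \<open>L\<^sup>2\<close> is at most \<open>(R powr (N - 1) / w) powr (1 / 2)\<close>;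
    \<^item> the \<open>L\<close>-norm with exponents \<open>p, q, b\<close> is at most
      \<open>(R powr (1 - b) * (R powr (N - 1) * w) powr q) powr (1 / (p * q))\<close>, because the mass of \<open>u\<close> in the ball of
      radius \<open>\<rho>\<close> vanishes for \<open>\<rho> \<le> R / 2\<close> and is bounded by the volume of the annulus.

  The exponent \<open>a\<close> (\<open>critical_width\<close>) is chosen so that the last two bounds are the same power
  \<open>e = (N - 1 - a) / 2\<close> of \<open>R\<close>. The condition \<open>b < b\<^sub>*\<close> says exactly that \<open>a < 1\<close>, which makes the annulus
  thin compared with its radius, and a positive \<open>s\<close> lies below the critical exponent exactly when \<open>e < (N - 1 + a) / s\<close>
  (\<open>critical_width_exponents\<close>). So the quotient of the \<open>L\<^sup>s\<close> norm by the norm of the space \<open>E\<close> grows like a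
  positive power of \<open>R\<close> (\<open>ring_bump_family\<close>).

  The bumps are only \<open>C\<^sup>1\<close>. Their classical gradient is a weak gradient, by integration by parts
  (\<open>C1_has_weak_gradient\<close>). The norm of \<open>E\<close> involves a weak gradient picked by a choice operator, so
  one also needs that weak gradients are unique almost everywhere (\<open>weak_gradient_unique_AE\<close>); this rests on
  the fundamental lemma of the calculus of variations and on smooth approximations of indicators of boxes.
\<close>

section \<open>Classical gradients are weak gradients\<close>

lemma differentiable_imp_continuous_on_UNIV:
  fixes f :: "'a::real_normed_vector \<Rightarrow> 'b::real_normed_vector"
  assumes "\<forall>x. f differentiable (at x)"
  shows "continuous_on UNIV f"
  using assms by (meson continuous_on_eq_continuous_at differentiable_imp_continuous_within open_UNIV)

lemma pdiff_eqI:
  assumes "(f has_derivative D) (at x)"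
  shows "pdiff i f x = D (axis i 1)"
  unfolding pdiff_def by (simp add: frechet_derivative_at[OF assms, symmetric])

lemma has_field_derivative_along_axis:
  fixes F :: "real ^ 'n::finite \<Rightarrow> real"
  assumes "\<forall>x. F differentiable (at x)"
  shows "((\<lambda>t. F (x + t *\<^sub>R axis i 1)) has_real_derivative pdiff i F (x + t *\<^sub>R axis i 1)) (at t)"
proof -
  let ?y = "x + t *\<^sub>R axis i 1"
  have D: "(F has_derivative frechet_derivative F (at ?y)) (at ?y)"
    using assms frechet_derivative_works by blast
  have "((\<lambda>t. F (x + t *\<^sub>R axis i 1)) has_derivative
      (\<lambda>h. frechet_derivative F (at ?y) (h *\<^sub>R axis i 1))) (at t)"
    by (rule has_derivative_compose[where f = "\<lambda>t. x + t *\<^sub>R axis i 1" and g = F and x = t, OF _ D])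
      (auto intro!: derivative_eq_intros)
  moreover have "frechet_derivative F (at ?y) (h *\<^sub>R axis i 1) = pdiff i F ?y * h" for h
    using has_derivative_linear[OF D] by (simp add: pdiff_def linear_cmul)
  ultimately show ?thesis
    by (simp add: has_field_derivative_def)
qed

text \<open>
  No Fubini argument is needed: the integrals of the difference quotients of \<open>F\<close> vanish by translation
  invariance of the Lebesgue measure, and they converge to the integral of the partial derivative by
  dominated convergence.
\<close>

lemma integral_pdiff_eq_0:
  fixes F :: "real ^ 'n::finite \<Rightarrow> real"
  assumes F: "\<forall>x. F differentiable (at x)"
    and D: "continuous_on UNIV (pdiff i F)"
    and supp: "\<And>x. r \<le> norm x \<Longrightarrow> F x = 0"
  shows "(LINT x|lborel. pdiff i F x) = 0"
proof -
  let ?e = "axis i (1::real) :: real ^ 'n"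
  define h where "h n = 1 / real (Suc n)" for n
  define Q where "Q n x = (F (x + h n *\<^sub>R ?e) - F x) / h n" for n x
  have h: "0 < h n" "h n \<le> 1" for n by (auto simp: h_def)
  have h0: "h \<longlonglongrightarrow> 0" unfolding h_def
    using LIMSEQ_inverse_real_of_nat by (simp add: divide_inverse)
  have contF: "continuous_on UNIV F"
    by (rule differentiable_imp_continuous_on_UNIV[OF F])
  have intF: "integrable lborel F"
  proof -
    have "integrable lborel (\<lambda>x. indicator (cball 0 r) x *\<^sub>R F x)"
      by (rule borel_integrable_compact) (auto intro: continuous_on_subset[OF contF])
    moreover have "(\<lambda>x. indicator (cball 0 r) x *\<^sub>R F x) = F"
      using supp by (force simp: indicator_def fun_eq_iff)
    ultimately show ?thesis by simp
  qed
  have intT: "integrable lborel (\<lambda>x. F (x + c))" "(LINT x|lborel. F (x + c)) = (LINT x|lborel. F x)" for c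
  proof -
    have [measurable]: "F \<in> borel_measurable borel" using contF by (rule borel_measurable_continuous_onI)
    have "integrable (distr lborel borel (\<lambda>x. c + x)) F"
      using intF by (simp add: lborel_distr_plus)
    then show "integrable lborel (\<lambda>x. F (x + c))"
      by (subst (asm) integrable_distr_eq) (auto simp: add.commute)
    have "(LINT x|lborel. F x) = (LINT x|distr lborel borel (\<lambda>x. c + x). F x)"
      by (simp add: lborel_distr_plus)
    also have "\<dots> = (LINT x|lborel. F (x + c))"
      by (subst integral_distr) (auto simp: add.commute)
    finally show "(LINT x|lborel. F (x + c)) = (LINT x|lborel. F x)" by simp
  qed
  have Q0: "(LINT x|lborel. Q n x) = 0" for n
    using intF intT unfolding Q_def by simp
  \<comment> \<open>The quotients, formed with steps of length at most 1, vanish off the ball of radius \<open>r + 1\<close>;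
    the intermediate points of the mean value theorem stay in the ball of radius \<open>r + 2\<close>.\<close>
  let ?K = "cball (0::real ^ 'n) (r + 2)"
  have "bounded (pdiff i F ` ?K)"
    by (intro compact_imp_bounded compact_continuous_image continuous_on_subset[OF D]) auto
  then obtain M where M: "\<And>x. x \<in> ?K \<Longrightarrow> \<bar>pdiff i F x\<bar> \<le> M"
    unfolding bounded_iff by (metis imageI real_norm_def)
  have bd: "norm (Q n x) \<le> indicator ?K x *\<^sub>R M" for n x
  proof (cases "norm x \<le> r + 1")
    case True
    have "\<exists>z>0. z < h n \<and> F (x + h n *\<^sub>R ?e) - F (x + 0 *\<^sub>R ?e) = (h n - 0) * pdiff i F (x + z *\<^sub>R ?e)"
      by (rule MVT2) (auto intro: has_field_derivative_along_axis[OF F] h)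
    then obtain z where z: "0 < z" "z < h n" "F (x + h n *\<^sub>R ?e) - F x = h n * pdiff i F (x + z *\<^sub>R ?e)"
      by auto
    have "Q n x = pdiff i F (x + z *\<^sub>R ?e)"
      using z(3) h(1)[of n] by (simp add: Q_def)
    moreover have "norm (x + z *\<^sub>R ?e) \<le> norm x + z"
      using norm_triangle_ineq[of x "z *\<^sub>R ?e"] z(1) by simp
    then have "x + z *\<^sub>R ?e \<in> ?K" using True z(2) h(2)[of n] by simp
    ultimately show ?thesis using M True by simp
  next
    case False
    have "norm x \<le> norm (x + h n *\<^sub>R ?e) + h n"
      using norm_triangle_ineq4[of "x + h n *\<^sub>R ?e" "h n *\<^sub>R ?e"] h(1)[of n] by simp
    then have "F (x + h n *\<^sub>R ?e) = 0" using False h(2)[of n] by (intro supp) simp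
    moreover have "F x = 0" using False by (intro supp) simp
    moreover have "x \<in> ?K \<Longrightarrow> 0 \<le> M" using M[of x] by simp
    ultimately show ?thesis unfolding Q_def by (auto simp: indicator_def)
  qed
  have lim: "(\<lambda>n. Q n x) \<longlonglongrightarrow> pdiff i F x" for x
  proof -
    have "((\<lambda>t. (F (x + (0 + t) *\<^sub>R ?e) - F (x + 0 *\<^sub>R ?e)) / t) \<longlongrightarrow> pdiff i F (x + 0 *\<^sub>R ?e)) (at 0)"
      using has_field_derivative_along_axis[OF F, where t=0 and x=x and i=i] unfolding DERIV_def .
    moreover have "filterlim h (at 0) sequentially"
      using h0 h(1) by (auto simp: filterlim_at intro!: always_eventually less_imp_neq[symmetric])
    ultimately show ?thesis
      unfolding Q_def by (auto dest: filterlim_compose)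
  qed
  have "(\<lambda>n. LINT x|lborel. Q n x) \<longlonglongrightarrow> (LINT x|lborel. pdiff i F x)"
  proof (rule integral_dominated_convergence)
    show "pdiff i F \<in> borel_measurable lborel"
      using D by (simp add: borel_measurable_continuous_onI)
    show "Q n \<in> borel_measurable lborel" for n
      using intF intT(1) unfolding Q_def by (auto dest: borel_measurable_integrable)
    show "integrable lborel (\<lambda>x. indicator ?K x *\<^sub>R M)"
      by (rule borel_integrable_compact) auto
    show "AE x in lborel. norm (Q n x) \<le> indicator ?K x *\<^sub>R M" for n
      by (intro AE_I2 bd)
    show "AE x in lborel. (\<lambda>n. Q n x) \<longlonglongrightarrow> pdiff i F x"
      by (intro AE_I2 lim)
  qed
  then show ?thesis by (simp add: Q0 LIMSEQ_const_iff)
qed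

lemma pdiff_mult:
  assumes "f differentiable (at x)" "g differentiable (at x)"
  shows "pdiff i (\<lambda>x. f x * g x) x = pdiff i f x * g x + f x * pdiff i g x"
proof -
  have "((\<lambda>x. f x * g x) has_derivative (\<lambda>h. f x * frechet_derivative g (at x) h + frechet_derivative f (at x) h * g x)) (at x)"
    using assms by (intro has_derivative_mult) (simp_all add: frechet_derivative_works[symmetric])
  from pdiff_eqI[OF this] show ?thesis by (simp add: pdiff_def)
qed

lemma pdiff_add:
  assumes "f differentiable (at x)" "g differentiable (at x)"
  shows "pdiff i (\<lambda>x. f x + g x) x = pdiff i f x + pdiff i g x"
proof -
  have "((\<lambda>x. f x + g x) has_derivative (\<lambda>h. frechet_derivative f (at x) h + frechet_derivative g (at x) h)) (at x)"
    using assms by (intro has_derivative_add) (simp_all add: frechet_derivative_works[symmetric])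
  from pdiff_eqI[OF this] show ?thesis by (simp add: pdiff_def)
qed

lemma test_functionsD:
  assumes "\<phi> \<in> test_functions"
  shows "\<forall>x. \<phi> differentiable (at x)" "continuous_on UNIV (pdiff i \<phi>)"
    "\<exists>r. \<forall>x. r \<le> norm x \<longrightarrow> \<phi> x = 0"
proof -
  have k: "C_k k \<phi>" for k
    using assms by (simp add: test_functions_def)
  have cpt: "compact (closure {x. \<phi> x \<noteq> 0})"
    using assms by (simp add: test_functions_def)
  show "\<forall>x. \<phi> differentiable (at x)" "continuous_on UNIV (pdiff i \<phi>)"
    using k[of "Suc 0"] by simp_all
  obtain B where B: "\<And>x. x \<in> closure {x. \<phi> x \<noteq> 0} \<Longrightarrow> norm x \<le> B"
    using compact_imp_bounded[OF cpt] unfolding bounded_iff by auto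
  have "\<phi> x = 0" if "B + 1 \<le> norm x" for x
  proof (rule ccontr)
    assume "\<phi> x \<noteq> 0"
    then have "x \<in> closure {x. \<phi> x \<noteq> 0}" using closure_subset by force
    with B[of x] that show False by simp
  qed
  then show "\<exists>r. \<forall>x. r \<le> norm x \<longrightarrow> \<phi> x = 0" by blast
qed

lemma continuous_imp_locally_integrable:
  fixes f :: "'a::euclidean_space \<Rightarrow> 'b::euclidean_space"
  assumes "continuous_on UNIV f"
  shows "locally_integrable f"
  unfolding locally_integrable_def
proof (intro allI impI)
  fix K :: "'a set" assume K: "compact K"
  have "integrable lborel (\<lambda>x. indicator K x *\<^sub>R f x)"
    by (rule borel_integrable_compact[OF K continuous_on_subset[OF assms]]) simp
  then show "f absolutely_integrable_on K"
    unfolding set_integrable_def by (rule integrable_completion[THEN iffD2, rotated])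
      (use \<open>integrable lborel _\<close> in \<open>auto dest: borel_measurable_integrable\<close>)
qed

lemma C1_has_weak_gradient:
  fixes u :: "real ^ 'n::finite \<Rightarrow> real"
  assumes "C_k 1 u"
  shows "has_weak_gradient u (\<lambda>x. \<chi> i. pdiff i u x)"
  unfolding has_weak_gradient_def
proof (intro conjI ballI allI)
  have u: "\<forall>x. u differentiable (at x)" and Du: "continuous_on UNIV (pdiff i u)" for i
    using assms by auto
  have cu: "continuous_on UNIV u" by (rule differentiable_imp_continuous_on_UNIV[OF u])
  then show "locally_integrable u" by (rule continuous_imp_locally_integrable)
  show "locally_integrable (\<lambda>x. \<chi> i. pdiff i u x)"
    by (intro continuous_imp_locally_integrable continuous_on_vec_lambda Du)
  fix \<phi> :: "real ^ 'n \<Rightarrow> real" and i assume phi: "\<phi> \<in> test_functions"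
  note phiD = test_functionsD(1,2)[OF phi]
  have cphi: "continuous_on UNIV \<phi>" by (rule differentiable_imp_continuous_on_UNIV[OF phiD(1)])
  obtain r where r: "\<And>x. r \<le> norm x \<Longrightarrow> \<phi> x = 0" using test_functionsD(3)[OF phi] by blast
  have dphi0: "pdiff i \<phi> x = 0" if "r + 1 \<le> norm x" for x
  proof -
    have "(\<phi> has_derivative (\<lambda>_. 0)) (at x)"
    proof (rule has_derivative_transform_within_open[of "\<lambda>_. 0"])
      show "open (- cball (0 :: real ^ 'n) r)" by (intro open_Compl closed_cball)
    qed (use that r in auto)
    from pdiff_eqI[OF this] show ?thesis by simp
  qed
  have int: "integrable lborel g" if "continuous_on UNIV g" "\<And>x. r + 1 \<le> norm x \<Longrightarrow> g x = 0"
    for g :: "real ^ 'n \<Rightarrow> real"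
  proof -
    have "integrable lborel (\<lambda>x. indicator (cball 0 (r + 1)) x *\<^sub>R g x)"
      by (rule borel_integrable_compact) (auto intro: continuous_on_subset[OF that(1)])
    moreover have "(\<lambda>x. indicator (cball 0 (r + 1)) x *\<^sub>R g x) = g"
      using that(2) by (force simp: indicator_def fun_eq_iff)
    ultimately show ?thesis by simp
  qed
  have i1: "integrable lborel (\<lambda>x. pdiff i u x * \<phi> x)"
    by (intro int continuous_on_mult Du cphi) (auto intro: r)
  have i2: "integrable lborel (\<lambda>x. u x * pdiff i \<phi> x)"
    by (intro int continuous_on_mult cu phiD) (auto intro: dphi0)
  have eq: "pdiff i (\<lambda>x. u x * \<phi> x) = (\<lambda>x. pdiff i u x * \<phi> x + u x * pdiff i \<phi> x)"
    using u phiD(1) by (auto simp: pdiff_mult)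
  have "(LINT x|lborel. pdiff i (\<lambda>x. u x * \<phi> x) x) = 0"
  proof (rule integral_pdiff_eq_0[where r = r])
    show "\<forall>x. (\<lambda>x. u x * \<phi> x) differentiable at x"
      using u phiD(1) by (auto intro: differentiable_mult)
    show "continuous_on UNIV (pdiff i (\<lambda>x. u x * \<phi> x))"
      unfolding eq by (intro continuous_intros Du cphi cu phiD)
  qed (auto intro: r)
  then have "(LINT x|lborel. u x * pdiff i \<phi> x) = - (LINT x|lborel. pdiff i u x * \<phi> x)"
    unfolding eq using i1 i2 by simp
  moreover have "(LINT x|lebesgue. u x * pdiff i \<phi> x) = (LINT x|lborel. u x * pdiff i \<phi> x)"
    by (rule integral_completion) (use i2 in \<open>auto dest: borel_measurable_integrable\<close>)
  moreover have "(LINT x|lebesgue. pdiff i u x * \<phi> x) = (LINT x|lborel. pdiff i u x * \<phi> x)"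
    by (rule integral_completion) (use i1 in \<open>auto dest: borel_measurable_integrable\<close>)
  ultimately show "(LINT x|lebesgue. u x * pdiff i \<phi> x)
      = - (LINT x|lebesgue. (\<chi> i. pdiff i u x) $ i * \<phi> x)"
    by simp
qed

section \<open>Smooth bump functions\<close>

text \<open>
  The functions \<open>x powr (- k) * exp (-1/x)\<close>, extended by 0 to the left half-line. The derivative of each
  is a linear combination of two others (\<open>flat_exp_has_derivative\<close>), so all of them are smooth.
\<close>

definition flat_exp :: "nat \<Rightarrow> real \<Rightarrow> real" where
  "flat_exp k x = (if x \<le> 0 then 0 else (1 / x) ^ k * exp (- (1 / x)))"

lemma flat_exp_tendsto_0: "(flat_exp k \<longlongrightarrow> 0) (at_right 0)"
proof -
  have "((\<lambda>y::real. y ^ k / exp y) \<longlongrightarrow> 0) at_top" by (rule tendsto_power_div_exp_0)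
  then have "((\<lambda>x::real. inverse x ^ k / exp (inverse x)) \<longlongrightarrow> 0) (at_right 0)"
    by (rule filterlim_compose[OF _ filterlim_inverse_at_top_right])
  moreover have "\<forall>\<^sub>F x in at_right 0. inverse x ^ k / exp (inverse x) = flat_exp k x"
    unfolding eventually_at_right_field
    by (intro exI[of _ 1]) (auto simp: flat_exp_def exp_minus field_simps)
  ultimately show ?thesis by (rule Lim_transform_eventually)
qed

lemma flat_exp_has_derivative:
  "(flat_exp k has_real_derivative flat_exp (k + 2) x - k * flat_exp (k + 1) x) (at x)"
proof -
  consider "x < 0" | "x > 0" | "x = 0" by linarith
  then show ?thesis
  proof cases
    case 1
    have "(flat_exp k has_real_derivative 0) (at x)"
      by (rule has_field_derivative_transform_within_open[OF DERIV_const, where S = "{..<0}"])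
        (use 1 in \<open>auto simp: flat_exp_def\<close>)
    then show ?thesis using 1 by (simp add: flat_exp_def)
  next
    case 2
    have "((\<lambda>x. (1 / x) ^ k * exp (- (1 / x))) has_real_derivative
        flat_exp (k + 2) x - k * flat_exp (k + 1) x) (at x)"
    proof -
      have "((\<lambda>x. (1 / x) ^ k * exp (- (1 / x))) has_real_derivative
          (real k * (1 / x) ^ (k - 1) * (- (1 / x\<^sup>2))) * exp (- (1 / x))
          + (1 / x) ^ k * (exp (- (1 / x)) * (1 / x\<^sup>2))) (at x)"
      proof -
        have D: "((\<lambda>x. 1 / x) has_real_derivative - (1 / x\<^sup>2)) (at x)"
          using 2 by (auto intro!: derivative_eq_intros simp: power2_eq_square)
        show ?thesis
          by (rule DERIV_cong[OF DERIV_mult[OF DERIV_power[OF D] DERIV_chain2[OF DERIV_exp DERIV_minus[OF D]]]])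
            simp
      qed
      moreover have "real k * (1 / x) ^ (k - 1) * (- (1 / x\<^sup>2)) * exp (- (1 / x))
          + (1 / x) ^ k * (exp (- (1 / x)) * (1 / x\<^sup>2)) = flat_exp (k + 2) x - k * flat_exp (k + 1) x"
        using 2 by (cases k) (simp_all add: flat_exp_def power2_eq_square)
      ultimately show ?thesis by simp
    qed
    then show ?thesis
      by (rule has_field_derivative_transform_within_open[of _ _ _ "{0<..}"])
        (use 2 in \<open>auto simp: flat_exp_def\<close>)
  next
    case 3
    have "((\<lambda>h. flat_exp k h / h) \<longlongrightarrow> 0) (at_right 0)"
    proof (rule Lim_transform_eventually[OF flat_exp_tendsto_0[of "Suc k"]])
      show "\<forall>\<^sub>F x in at_right 0. flat_exp (Suc k) x = flat_exp k x / x"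
        unfolding eventually_at_right_field by (intro exI[of _ 1]) (auto simp: flat_exp_def)
    qed
    moreover have "((\<lambda>h. flat_exp k h / h) \<longlongrightarrow> 0) (at_left 0)"
    proof (rule Lim_transform_eventually[OF tendsto_const])
      show "\<forall>\<^sub>F x in at_left 0. 0 = flat_exp k x / x"
        unfolding eventually_at_left_field by (intro exI[of _ "-1"]) (auto simp: flat_exp_def)
    qed
    ultimately have "((\<lambda>h. flat_exp k h / h) \<longlongrightarrow> 0) (at 0)"
      by (simp add: filterlim_split_at)
    then show ?thesis using 3 by (simp add: DERIV_def flat_exp_def)
  qed
qed

text \<open>
  The algebra of functions generated by the constants and by \<open>flat_exp\<close> composed with affine functions of one
  coordinate. It is closed under partial derivatives, hence consists of smooth functions.
\<close>

inductive_set flat_algebra :: "(real ^ 'n::finite \<Rightarrow> real) set" where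
  const: "(\<lambda>_. c) \<in> flat_algebra"
| base: "(\<lambda>x. flat_exp k (\<alpha> * x $ i + \<beta>)) \<in> flat_algebra"
| add: "f \<in> flat_algebra \<Longrightarrow> g \<in> flat_algebra \<Longrightarrow> (\<lambda>x. f x + g x) \<in> flat_algebra"
| mult: "f \<in> flat_algebra \<Longrightarrow> g \<in> flat_algebra \<Longrightarrow> (\<lambda>x. f x * g x) \<in> flat_algebra"

lemma flat_algebra_pdiff:
  fixes f :: "real ^ 'n::finite \<Rightarrow> real"
  assumes "f \<in> flat_algebra"
  shows "(\<forall>x. f differentiable (at x)) \<and> (\<forall>i. pdiff i f \<in> flat_algebra)"
  using assms
proof induction
  case (const c)
  have "pdiff i (\<lambda>_. c) = (\<lambda>_. 0)" for i :: 'n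
    using pdiff_eqI[OF has_derivative_const] by blast
  then show ?case by (auto intro: flat_algebra.const)
next
  case (base k \<alpha> j \<beta>)
  let ?f = "\<lambda>x::real ^ 'n. flat_exp k (\<alpha> * x $ j + \<beta>)"
  let ?d = "\<lambda>x::real ^ 'n. flat_exp (k + 2) (\<alpha> * x $ j + \<beta>) + (- real k) * flat_exp (k + 1) (\<alpha> * x $ j + \<beta>)"
  have D: "(?f has_derivative (\<lambda>h. ?d x * (\<alpha> * h $ j))) (at x)" for x
  proof -
    have "((\<lambda>x::real ^ 'n. \<alpha> * x $ j + \<beta>) has_derivative (\<lambda>h. \<alpha> * h $ j)) (at x)"
      by (auto intro!: derivative_eq_intros bounded_linear_imp_has_derivative bounded_linear_vec_nth)
    from has_derivative_compose[OF this has_field_derivative_imp_has_derivative[OF flat_exp_has_derivative]]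
    show ?thesis by simp
  qed
  have "pdiff i ?f = (\<lambda>x. ?d x * (\<lambda>_. \<alpha> * axis i 1 $ j) x)" for i
    using pdiff_eqI[OF D] by blast
  moreover have "(\<lambda>x. ?d x * (\<lambda>_. \<alpha> * axis i 1 $ j) x) \<in> flat_algebra" for i :: 'n
    by (intro flat_algebra.intros)
  ultimately show ?case using D by (auto simp: differentiable_def)
next
  case (add f g)
  then have "pdiff i (\<lambda>x. f x + g x) = (\<lambda>x. pdiff i f x + pdiff i g x)" for i
    by (auto simp: pdiff_add)
  with add show ?case by (auto intro!: flat_algebra.add differentiable_add)
next
  case (mult f g)
  then have "pdiff i (\<lambda>x. f x * g x) = (\<lambda>x. pdiff i f x * g x + f x * pdiff i g x)" for i
    by (auto simp: pdiff_mult)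
  with mult show ?case by (auto intro!: flat_algebra.add flat_algebra.mult differentiable_mult)
qed

lemma flat_algebra_C_k: "f \<in> flat_algebra \<Longrightarrow> C_k k f"
proof (induction k arbitrary: f)
  case 0
  then show ?case
    using differentiable_imp_continuous_on_UNIV[OF conjunct1[OF flat_algebra_pdiff]] by simp
next
  case (Suc k)
  then show ?case using flat_algebra_pdiff[OF Suc.prems] by auto
qed

lemma flat_algebra_prod:
  "finite I \<Longrightarrow> (\<And>i. i \<in> I \<Longrightarrow> f i \<in> flat_algebra) \<Longrightarrow> (\<lambda>x. \<Prod>i\<in>I. f i x) \<in> flat_algebra"
  by (induction I rule: finite_induct) (auto intro: flat_algebra.intros)

text \<open>
  Smooth functions that are supported in the box with corners \<open>a\<close> and \<open>b\<close> and converge pointwise to the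
  indicator of the open box as \<open>m\<close> tends to infinity. With the factor \<open>m\<close> in place of \<open>Suc m\<close> the function for \<open>m = 0\<close> would vanish.
\<close>

definition box_bump :: "real ^ 'n::finite \<Rightarrow> real ^ 'n \<Rightarrow> nat \<Rightarrow> real ^ 'n \<Rightarrow> real" where
  "box_bump a b m x =
     (\<Prod>i\<in>UNIV. flat_exp 0 (real (Suc m) * (x $ i - a $ i)) * flat_exp 0 (real (Suc m) * (b $ i - x $ i)))"

lemma box_bump_outside: "x \<notin> box a b \<Longrightarrow> box_bump a b m x = 0"
proof -
  assume "x \<notin> box a b"
  then obtain i where "\<not> (a $ i < x $ i \<and> x $ i < b $ i)"
    unfolding mem_box_cart by blast
  then show "box_bump a b m x = 0"
    unfolding box_bump_def by (intro prod_zero) (auto simp: flat_exp_def mult_le_0_iff not_less)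
qed

lemma box_bump_bounds: "0 \<le> box_bump a b m x" "box_bump a b m x \<le> 1"
proof -
  have "0 \<le> flat_exp 0 y \<and> flat_exp 0 y \<le> 1" for y
    by (simp add: flat_exp_def)
  then show "0 \<le> box_bump a b m x" "box_bump a b m x \<le> 1"
    unfolding box_bump_def by (auto intro!: prod_nonneg prod_le_1 mult_le_one)
qed

lemma box_bump_test: "box_bump a b m \<in> test_functions"
proof -
  have "(\<lambda>x. flat_exp 0 (real (Suc m) * x $ i + - (real (Suc m) * a $ i))
      * flat_exp 0 ((- real (Suc m)) * x $ i + real (Suc m) * b $ i)) \<in> flat_algebra" for i
    by (intro flat_algebra.intros)
  then have "(\<lambda>x. \<Prod>i\<in>UNIV. flat_exp 0 (real (Suc m) * x $ i + - (real (Suc m) * a $ i))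
      * flat_exp 0 ((- real (Suc m)) * x $ i + real (Suc m) * b $ i)) \<in> flat_algebra"
    by (intro flat_algebra_prod) auto
  moreover have "(\<lambda>x. \<Prod>i\<in>UNIV. flat_exp 0 (real (Suc m) * x $ i + - (real (Suc m) * a $ i))
      * flat_exp 0 ((- real (Suc m)) * x $ i + real (Suc m) * b $ i)) = box_bump a b m"
    by (simp add: box_bump_def algebra_simps fun_eq_iff)
  ultimately have "box_bump a b m \<in> flat_algebra" by simp
  moreover have "{x. box_bump a b m x \<noteq> 0} \<subseteq> cbox a b"
    using box_bump_outside box_subset_cbox by blast
  then have "bounded {x. box_bump a b m x \<noteq> 0}"
    using bounded_cbox bounded_subset by blast
  ultimately show ?thesis
    by (simp add: test_functions_def flat_algebra_C_k compact_closure)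
qed

lemma box_bump_tendsto:
  fixes a b x :: "real ^ 'n::finite"
  shows "(\<lambda>m. box_bump a b m x) \<longlonglongrightarrow> indicator (box a b) x"
proof (cases "x \<in> box a b")
  case True
  have lim: "(\<lambda>m. flat_exp 0 (real (Suc m) * y)) \<longlonglongrightarrow> 1" if "y > 0" for y
  proof -
    have "(\<lambda>m. exp (- (inverse (real (Suc m)) * (1 / y)))) \<longlonglongrightarrow> exp (- (0 * (1 / y)))"
      by (intro tendsto_intros LIMSEQ_inverse_real_of_nat)
    moreover have "exp (- (inverse (real (Suc m)) * (1 / y))) = flat_exp 0 (real (Suc m) * y)" for m
      using that mult_pos_pos[of "real (Suc m)" y] unfolding flat_exp_def by (simp add: field_simps)
    ultimately show ?thesis by simp
  qed
  have "(\<lambda>m. box_bump a b m x) \<longlonglongrightarrow> (\<Prod>i\<in>(UNIV::'n set). 1 * 1)"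
    unfolding box_bump_def using True by (intro tendsto_prod tendsto_mult lim) (auto simp: mem_box_cart)
  then show ?thesis using True by simp
next
  case False
  then show ?thesis by (simp add: box_bump_outside)
qed

section \<open>Almost everywhere uniqueness of the weak gradient\<close>

text \<open>
  The sets on which the integral of \<open>h\<close> vanishes form a Dynkin system, and the boxes form an intersection-stable
  generator of the Borel sets.
\<close>

lemma AE_eq_0_if_box_integrals_0:
  fixes h :: "'a::euclidean_space \<Rightarrow> real"
  assumes int: "integrable lborel h"
    and box: "\<And>a b. (LINT x|lborel. indicator (box a b) x * h x) = 0"
    and UN: "(LINT x|lborel. h x) = 0"
  shows "AE x in lborel. h x = 0"
proof (rule sigma_finite_measure.density_zero[OF sigma_finite_lborel int])
  have ind: "integrable lborel (\<lambda>x. indicator A x * h x)" if "A \<in> sets borel" for A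
    using integrable_mult_indicator[of A lborel h] int that by simp
  fix A :: "'a set" assume "A \<in> sets lborel"
  then have gen: "A \<in> sigma_sets UNIV (range (\<lambda>(a, b). box a b :: 'a set))"
    by (simp add: borel_eq_box)
  have stable: "Int_stable (range (\<lambda>(a, b). box a b :: 'a set))"
    unfolding Int_stable_def using box_Int_box by (metis (no_types, lifting) case_prod_conv rangeE rangeI surj_pair)
  have borel: "B \<in> sets borel" if "B \<in> sigma_sets UNIV (range (\<lambda>(a, b). box a b :: 'a set))" for B
    using that by (simp add: borel_eq_box)
  have closed: "range (\<lambda>(a, b). box a b :: 'a set) \<subseteq> Pow UNIV" by simp
  from stable closed gen have "(LINT x|lborel. indicator A x * h x) = 0"
  proof (induction rule: sigma_sets_induct_disjoint)
    case (basic A)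
    then show ?case using box by auto
  next
    case empty
    show ?case by simp
  next
    case (compl A)
    have "(LINT x|lborel. indicator (UNIV - A) x * h x)
        = (LINT x|lborel. h x - indicator A x * h x)"
      by (intro Bochner_Integration.integral_cong) (auto simp: indicator_def)
    also have "\<dots> = 0" using compl.IH int ind[OF borel[OF compl.hyps]] UN by simp
    finally show ?case .
  next
    case (union A)
    then have A: "A i \<in> sets borel" for i using borel by blast
    have "(LINT x:(\<Union>i. A i)|lborel. h x) = (\<Sum>i. (LINT x:(A i)|lborel. h x))"
      by (rule lebesgue_integral_countable_add)
        (use A union.hyps(1) ind[of "\<Union>i. A i"] in \<open>auto simp: disjoint_family_on_def set_integrable_def\<close>)
    then show ?case using union.IH by (simp add: set_lebesgue_integral_def)
  qed
  then show "set_lebesgue_integral lborel A h = 0"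
    by (simp add: set_lebesgue_integral_def)
qed

lemma fundamental_lemma_calculus_of_variations:
  fixes H :: "real ^ 'n::finite \<Rightarrow> real"
  assumes loc: "locally_integrable H"
    and zero: "\<And>\<phi>. \<phi> \<in> test_functions \<Longrightarrow> (LINT x|lebesgue. H x * \<phi> x) = 0"
  shows "AE x in lebesgue. H x = 0"
proof -
  have Hm [measurable]: "H \<in> borel_measurable lebesgue"
  proof (rule borel_measurable_LIMSEQ_real)
    show "(\<lambda>x. indicator (cball 0 (real n)) x *\<^sub>R H x) \<in> borel_measurable lebesgue" for n
      using loc unfolding locally_integrable_def set_integrable_def
      by (blast intro: borel_measurable_integrable compact_cball)
    show "(\<lambda>n. indicator (cball 0 (real n)) x *\<^sub>R H x) \<longlonglongrightarrow> H x" for x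
    proof (rule tendsto_eventually)
      obtain n where "norm x \<le> real n" using real_arch_simple by blast
      then show "\<forall>\<^sub>F n in sequentially. indicator (cball 0 (real n)) x *\<^sub>R H x = H x"
        by (intro eventually_sequentiallyI[of n]) auto
    qed
  qed
  \<comment> \<open>A Borel measurable version \<open>G\<close> of \<open>H\<close> allows to integrate with respect to \<open>lborel\<close>.\<close>
  from completion_ex_borel_measurable_real[OF Hm]
  obtain G where G [measurable]: "G \<in> borel_measurable borel" and "AE x in lborel. H x = G x"
    by auto
  then have HG: "AE x in lebesgue. H x = G x" by (simp add: AE_completion_iff)
  have int: "integrable lborel (\<lambda>x. indicator (cbox a b) x * G x)" for a b
  proof -
    have "integrable lebesgue (\<lambda>x. indicator (cbox a b) x * H x)"
      using loc unfolding locally_integrable_def set_integrable_def by (auto dest: spec[of _ "cbox a b"])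
    moreover have Gc: "(\<lambda>x. indicator (cbox a b) x * G x) \<in> borel_measurable lebesgue"
      by (rule measurable_completion) measurable
    ultimately have "integrable lebesgue (\<lambda>x. indicator (cbox a b) x * G x)"
      by (rule integrable_cong_AE_imp)
        (use HG Gc in auto)
    then show ?thesis by (subst (asm) integrable_completion) auto
  qed
  have box0: "(LINT x|lborel. indicator (box a b) x * G x) = 0" for a b
  proof -
    have bm: "box_bump a b m \<in> borel_measurable borel" for m
      using test_functionsD(1)[OF box_bump_test]
      by (intro borel_measurable_continuous_onI differentiable_imp_continuous_on_UNIV)
    have "(\<lambda>m. LINT x|lborel. box_bump a b m x * G x) \<longlonglongrightarrow> (LINT x|lborel. indicator (box a b) x * G x)"
    proof (rule integral_dominated_convergence)
      show "integrable lborel (\<lambda>x. norm (indicator (cbox a b) x * G x))"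
        by (intro integrable_norm int)
      show "AE x in lborel. (\<lambda>m. box_bump a b m x * G x) \<longlonglongrightarrow> indicator (box a b) x * G x"
        by (intro AE_I2 tendsto_intros box_bump_tendsto)
      show "AE x in lborel. norm (box_bump a b m x * G x) \<le> norm (indicator (cbox a b) x * G x)" for m
      proof (intro AE_I2)
        fix x
        show "norm (box_bump a b m x * G x) \<le> norm (indicator (cbox a b) x * G x)"
        proof (cases "x \<in> box a b")
          case True
          then have "x \<in> cbox a b" using box_subset_cbox by blast
          then show ?thesis
            using box_bump_bounds[of a b m x] by (simp add: abs_mult mult_left_le_one_le)
        qed (simp add: box_bump_outside)
      qed
    qed (use bm in measurable)
    moreover have "(LINT x|lborel. box_bump a b m x * G x) = 0" for m
    proof -
      have [measurable]: "box_bump a b m \<in> borel_measurable lebesgue" "G \<in> borel_measurable lebesgue"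
        using bm G by (auto intro: measurable_completion)
      have "(LINT x|lborel. box_bump a b m x * G x) = (LINT x|lebesgue. box_bump a b m x * G x)"
        by (rule integral_completion[symmetric]) (use bm in measurable)
      also have "\<dots> = (LINT x|lebesgue. H x * box_bump a b m x)"
        by (rule integral_cong_AE) (use HG in auto)
      finally show ?thesis using zero[OF box_bump_test] by simp
    qed
    ultimately show ?thesis by (simp add: LIMSEQ_const_iff)
  qed
  have "AE x in lborel. indicator (box (- (real n *\<^sub>R One)) (real n *\<^sub>R One)) x * G x = 0" for n
  proof (rule AE_eq_0_if_box_integrals_0)
    let ?B = "box (- (real n *\<^sub>R One)) (real n *\<^sub>R One) :: (real ^ 'n) set"
    let ?C = "cbox (- (real n *\<^sub>R One)) (real n *\<^sub>R One) :: (real ^ 'n) set"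
    have "integrable lborel (\<lambda>x. indicator ?B x *\<^sub>R (indicator ?C x * G x))"
      by (rule integrable_mult_indicator[OF _ int]) auto
    moreover have "indicator ?B x *\<^sub>R (indicator ?C x * G x) = indicator ?B x * G x" for x
      using box_subset_cbox[of "- (real n *\<^sub>R One) :: real ^ 'n" "real n *\<^sub>R One"]
      by (auto simp: indicator_def)
    ultimately show "integrable lborel (\<lambda>x. indicator ?B x * G x)" by (simp only:)
    show "(LINT x|lborel. indicator ?B x * G x) = 0" by (rule box0)
    show "(LINT x|lborel. indicator (box a b) x * (indicator ?B x * G x)) = 0" for a b
    proof -
      obtain c d where "box a b \<inter> ?B = box c d" using box_Int_box by blast
      then have "indicator (box a b) x * (indicator ?B x * G x) = indicator (box c d) x * G x" for x
        by (metis indicator_inter_arith mult.assoc)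
      then have "(\<lambda>x. indicator (box a b) x * (indicator ?B x * G x)) = (\<lambda>x. indicator (box c d) x * G x)"
        by (intro ext)
      then show ?thesis using box0 by (simp only:)
    qed
  qed
  then have "AE x in lborel. \<forall>n. indicator (box (- (real n *\<^sub>R One)) (real n *\<^sub>R One)) x * G x = 0"
    unfolding AE_all_countable by blast
  then have "AE x in lborel. G x = 0"
  proof (rule AE_mp, intro AE_I2 impI)
    fix x :: "real ^ 'n"
    assume *: "\<forall>n. indicator (box (- (real n *\<^sub>R One)) (real n *\<^sub>R One)) x * G x = 0"
    have "x \<in> (\<Union>i::nat. box (- (real i *\<^sub>R One)) (real i *\<^sub>R One))"
      unfolding UN_box_eq_UNIV by simp
    then obtain n where "x \<in> box (- (real n *\<^sub>R One)) (real n *\<^sub>R One)"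
      by blast
    then show "G x = 0" using *[rule_format, of n] by simp
  qed
  then have "AE x in lebesgue. G x = 0" by (rule AE_completion)
  with HG show ?thesis by eventually_elim simp
qed

lemma weak_gradient_unique_AE:
  fixes u :: "real ^ 'n::finite \<Rightarrow> real"
  assumes g: "has_weak_gradient u g" and g': "has_weak_gradient u g'"
  shows "AE x in lebesgue. g x = g' x"
proof -
  have comp: "locally_integrable (\<lambda>x. f x $ i)" if "locally_integrable f" for f :: "real ^ 'n \<Rightarrow> real ^ 'n" and i
    unfolding locally_integrable_def
  proof (intro allI impI)
    fix K :: "(real ^ 'n) set" assume "compact K"
    then have "f absolutely_integrable_on K" using that by (simp add: locally_integrable_def)
    from absolutely_integrable_linear[OF this bounded_linear_vec_nth[of i]]
    show "(\<lambda>x. f x $ i) absolutely_integrable_on K" by (simp add: o_def)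
  qed
  have "AE x in lebesgue. g x $ i - g' x $ i = 0" for i
  proof (rule fundamental_lemma_calculus_of_variations)
    have l: "locally_integrable (\<lambda>x. g x $ i)" "locally_integrable (\<lambda>x. g' x $ i)"
      using g g' comp by (auto simp: has_weak_gradient_def)
    then show "locally_integrable (\<lambda>x. g x $ i - g' x $ i)"
      unfolding locally_integrable_def by (auto intro: set_integral_diff(1))
    fix \<phi> :: "real ^ 'n \<Rightarrow> real" assume phi: "\<phi> \<in> test_functions"
    have int: "integrable lebesgue (\<lambda>x. f x * \<phi> x)" if "locally_integrable f" for f
    proof -
      obtain r where r: "\<And>x. r \<le> norm x \<Longrightarrow> \<phi> x = 0" using test_functionsD(3)[OF phi] by blast
      have "continuous_on UNIV \<phi>"
        by (rule differentiable_imp_continuous_on_UNIV[OF test_functionsD(1)[OF phi]])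
      then have "\<phi> \<in> borel_measurable lborel" and "compact (\<phi> ` cball 0 r)"
        by (auto intro!: borel_measurable_continuous_onI compact_continuous_image elim: continuous_on_subset)
      then have [measurable]: "\<phi> \<in> borel_measurable lebesgue" by (auto intro: measurable_completion)
      obtain B where B: "\<And>x. x \<in> cball 0 r \<Longrightarrow> \<bar>\<phi> x\<bar> \<le> B"
        using compact_imp_bounded[OF \<open>compact (\<phi> ` cball 0 r)\<close>]
        unfolding bounded_iff real_norm_def by blast
      have "f absolutely_integrable_on cball 0 r"
        using that by (simp add: locally_integrable_def)
      then have I: "integrable lebesgue (\<lambda>x. indicator (cball 0 r) x *\<^sub>R f x)"
        by (simp add: set_integrable_def)
      have "integrable lebesgue (\<lambda>x. (indicator (cball 0 r) x *\<^sub>R f x) * \<phi> x)"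
      proof (rule Bochner_Integration.integrable_bound[OF integrable_mult_left[OF I, of B]])
        show "(\<lambda>x. (indicator (cball 0 r) x *\<^sub>R f x) * \<phi> x) \<in> borel_measurable lebesgue"
          using borel_measurable_integrable[OF I] by measurable
        show "AE x in lebesgue. norm (indicator (cball 0 r) x *\<^sub>R f x * \<phi> x)
            \<le> norm (indicator (cball 0 r) x *\<^sub>R f x * B)"
        proof (intro AE_I2)
          fix x
          show "norm (indicator (cball 0 r) x *\<^sub>R f x * \<phi> x) \<le> norm (indicator (cball 0 r) x *\<^sub>R f x * B)"
            using B[of x] by (auto simp: indicator_def abs_mult intro!: mult_left_mono)
        qed
      qed
      moreover have "(\<lambda>x. (indicator (cball 0 r) x *\<^sub>R f x) * \<phi> x) = (\<lambda>x. f x * \<phi> x)"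
        using r by (force simp: indicator_def fun_eq_iff)
      ultimately show ?thesis by simp
    qed
    have "(LINT x|lebesgue. g x $ i * \<phi> x) = (LINT x|lebesgue. g' x $ i * \<phi> x)"
    proof -
      have "(LINT x|lebesgue. u x * pdiff i \<phi> x) = - (LINT x|lebesgue. g x $ i * \<phi> x)"
        "(LINT x|lebesgue. u x * pdiff i \<phi> x) = - (LINT x|lebesgue. g' x $ i * \<phi> x)"
        using g g' phi unfolding has_weak_gradient_def by blast+
      then show ?thesis by simp
    qed
    then show "(LINT x|lebesgue. (g x $ i - g' x $ i) * \<phi> x) = 0"
      using int[OF l(1)] int[OF l(2)] by (simp add: left_diff_distrib)
  qed
  then have "AE x in lebesgue. \<forall>i. g x $ i - g' x $ i = 0"
    by (simp add: AE_all_countable)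
  then show ?thesis by eventually_elim (simp add: vec_eq_iff)
qed

text \<open>
  This links the representative picked by the choice operator in \<open>weak_gradient\<close> with the classical gradient.
\<close>

lemma weak_gradient_C1_AE:
  fixes u :: "real ^ 'n::finite \<Rightarrow> real"
  assumes "C_k 1 u"
  shows "AE x in lebesgue. weak_gradient u x = (\<chi> i. pdiff i u x)"
proof (rule weak_gradient_unique_AE[OF _ C1_has_weak_gradient[OF assms]])
  show "has_weak_gradient u (weak_gradient u)"
    unfolding weak_gradient_def by (rule someI[of "has_weak_gradient u", OF C1_has_weak_gradient[OF assms]])
qed

section \<open>Radial bumps on thin annuli\<close>

lemma power_diff_bounds:
  fixes a b :: real
  assumes "0 \<le> a" "a \<le> b"
  shows "b ^ n - a ^ n \<le> real n * (b - a) * b ^ (n - 1)"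
    and "real n * (b - a) * a ^ (n - 1) \<le> b ^ n - a ^ n"
proof -
  have "\<exists>z. a \<le> z \<and> z \<le> b \<and> b ^ n - a ^ n = (b - a) * (real n * z ^ (n - 1))"
  proof (cases "a < b")
    case True
    have "\<exists>z>a. z < b \<and> b ^ n - a ^ n = (b - a) * (real n * z ^ (n - 1))"
      by (rule MVT2[OF True]) (auto intro!: derivative_eq_intros)
    then show ?thesis by (meson less_imp_le)
  next
    case False
    then show ?thesis using assms by (intro exI[of _ a]) auto
  qed
  then obtain z where z: "a \<le> z" "z \<le> b" "b ^ n - a ^ n = (b - a) * (real n * z ^ (n - 1))"
    by blast
  have "z ^ (n - 1) \<le> b ^ (n - 1)" "a ^ (n - 1) \<le> z ^ (n - 1)"
    using assms z by (auto intro!: power_mono)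
  then have "(b - a) * real n * z ^ (n - 1) \<le> (b - a) * real n * b ^ (n - 1)"
    "(b - a) * real n * a ^ (n - 1) \<le> (b - a) * real n * z ^ (n - 1)"
    using assms by (auto intro!: mult_left_mono)
  then show "b ^ n - a ^ n \<le> real n * (b - a) * b ^ (n - 1)"
    and "real n * (b - a) * a ^ (n - 1) \<le> b ^ n - a ^ n"
    using z(3) by (simp_all add: ac_simps)
qed

lemma emeasure_annulus:
  fixes r1 r2 :: real
  assumes "0 \<le> r1" "r1 \<le> r2"
  shows "emeasure lebesgue (ball (0::real ^ 'n::finite) r2 - ball 0 r1)
    = ennreal (measure lborel (ball (0::real ^ 'n) 1) * (r2 ^ CARD('n) - r1 ^ CARD('n)))"
proof -
  have em: "emeasure lebesgue (ball (0::real ^ 'n) r) = ennreal (measure lborel (ball (0::real ^ 'n) 1) * r ^ CARD('n))"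
    if "0 \<le> r" for r
  proof -
    have "emeasure lborel (ball (0::real ^ 'n) r) = ennreal (measure lborel (ball (0::real ^ 'n) r))"
      using emeasure_lborel_ball_finite[of "0 :: real ^ 'n" r] by (subst emeasure_eq_ennreal_measure) auto
    then show ?thesis
      using content_ball_conv_unit_ball[OF that, of "0 :: real ^ 'n"] by (simp add: mult.commute)
  qed
  have "emeasure lebesgue (ball (0::real ^ 'n) r2 - ball 0 r1)
      = emeasure lebesgue (ball (0::real ^ 'n) r2) - emeasure lebesgue (ball (0::real ^ 'n) r1)"
    by (rule emeasure_Diff) (use assms em in auto)
  also have "\<dots> = ennreal (measure lborel (ball (0::real ^ 'n) 1) * r2 ^ CARD('n) - measure lborel (ball (0::real ^ 'n) 1) * r1 ^ CARD('n))"
    using assms by (simp only: em order_trans[OF assms]) (intro ennreal_minus, simp)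
  finally show ?thesis by (simp add: right_diff_distrib)
qed

text \<open>
  A radial bump on the annulus of the points with norm between \<open>R - w\<close> and \<open>R + w\<close>, for \<open>0 < w \<le> R\<close>. It is
  written in terms of the square of the norm, which is a polynomial, so that no care is needed at the
  origin. The profile \<open>(max 0 (1 - v\<^sup>2))\<^sup>2\<close> is \<open>C\<^sup>1\<close>.
\<close>

definition ring_bump :: "real \<Rightarrow> real \<Rightarrow> real ^ 'n::finite \<Rightarrow> real" where
  "ring_bump R w x = (max 0 (1 - ((x \<bullet> x - R\<^sup>2) / (R * w))\<^sup>2))\<^sup>2"

text \<open>The gradient of \<open>ring_bump R w\<close> at \<open>x\<close> is \<open>ring_bump_slope R w x *\<^sub>R x\<close>.\<close>

definition ring_bump_slope :: "real \<Rightarrow> real \<Rightarrow> real ^ 'n::finite \<Rightarrow> real" where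
  "ring_bump_slope R w x =
     - (8 * max 0 (1 - ((x \<bullet> x - R\<^sup>2) / (R * w))\<^sup>2) * ((x \<bullet> x - R\<^sup>2) / (R * w)) / (R * w))"

lemma has_real_derivative_max_0_square:
  "((\<lambda>z::real. (max 0 z)\<^sup>2) has_real_derivative 2 * max 0 z) (at z)"
proof -
  consider "z < 0" | "z > 0" | "z = 0" by linarith
  then show ?thesis
  proof cases
    case 1
    have "((\<lambda>z::real. (max 0 z)\<^sup>2) has_real_derivative 0) (at z)"
      by (rule has_field_derivative_transform_within_open[OF DERIV_const, where S = "{..<0}"])
        (use 1 in auto)
    then show ?thesis using 1 by simp
  next
    case 2
    have "((\<lambda>z::real. z\<^sup>2) has_real_derivative 2 * z) (at z)"
      by (auto intro!: derivative_eq_intros)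
    then have "((\<lambda>z::real. (max 0 z)\<^sup>2) has_real_derivative 2 * z) (at z)"
      by (rule has_field_derivative_transform_within_open[where S = "{0<..}"]) (use 2 in auto)
    then show ?thesis using 2 by simp
  next
    case 3
    have "((\<lambda>h::real. max 0 h) \<longlongrightarrow> max 0 0) (at 0)"
      by (intro tendsto_intros)
    moreover have "(max 0 h)\<^sup>2 / h = max 0 h" for h :: real
      by (auto simp: max_def power2_eq_square)
    ultimately show ?thesis using 3 by (simp add: DERIV_def)
  qed
qed

lemma ring_bump_has_derivative:
  "(ring_bump R w has_derivative (\<lambda>h. ring_bump_slope R w x * (x \<bullet> h))) (at x)"
proof -
  let ?v = "\<lambda>x::real ^ 'a. (x \<bullet> x - R\<^sup>2) / (R * w)"
  have "((\<lambda>x::real ^ 'a. 1 - ((x \<bullet> x - R\<^sup>2) * inverse (R * w))\<^sup>2) has_derivative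
      (\<lambda>h. - (2 * ?v x * (2 * (x \<bullet> h) * inverse (R * w))))) (at x)"
    by (auto intro!: derivative_eq_intros simp: inner_commute divide_inverse)
  then have "((\<lambda>x::real ^ 'a. 1 - (?v x)\<^sup>2) has_derivative (\<lambda>h. - (2 * ?v x * (2 * (x \<bullet> h) / (R * w))))) (at x)"
    by (simp only: divide_inverse)
  from has_derivative_compose[OF this has_field_derivative_imp_has_derivative[OF has_real_derivative_max_0_square]]
  have "(ring_bump R w has_derivative
      (\<lambda>h. 2 * max 0 (1 - (?v x)\<^sup>2) * - (2 * ?v x * (2 * (x \<bullet> h) / (R * w))))) (at x)"
    unfolding ring_bump_def[abs_def] .
  moreover have "2 * m * - (2 * v * (2 * t / c)) = - (8 * m * v / c) * t" for m v t c :: real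
    by simp
  ultimately show ?thesis
    unfolding ring_bump_slope_def by (simp only:)
qed

lemma pdiff_ring_bump: "pdiff i (ring_bump R w) x = ring_bump_slope R w x * x $ i"
  using pdiff_eqI[OF ring_bump_has_derivative, of i R w x] by (simp add: inner_axis)

lemma ring_bump_C1: "C_k 1 (ring_bump R w :: real ^ 'n::finite \<Rightarrow> real)"
proof -
  have "continuous_on UNIV (\<lambda>x::real ^ 'n. ring_bump_slope R w x * x $ i)" for i
    unfolding ring_bump_slope_def divide_inverse by (intro continuous_intros)
  moreover have "pdiff i (ring_bump R w) = (\<lambda>x::real ^ 'n. ring_bump_slope R w x * x $ i)" for i
    using pdiff_ring_bump by blast
  moreover have "ring_bump R w differentiable (at x)" for x :: "real ^ 'n"
    unfolding differentiable_def by (rule exI, rule ring_bump_has_derivative)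
  ultimately show ?thesis by simp
qed

lemma ring_bump_bounds: "0 \<le> ring_bump R w x" "ring_bump R w x \<le> 1"
  unfolding ring_bump_def by (auto intro!: power_le_one)

lemma ring_bump_support:
  fixes x :: "real ^ 'n::finite"
  assumes w: "0 < w" "w \<le> R" and nz: "ring_bump R w x \<noteq> 0 \<or> ring_bump_slope R w x \<noteq> 0"
  shows "x \<in> ball 0 (R + w) - ball 0 (R - w)" and "\<bar>(x \<bullet> x - R\<^sup>2) / (R * w)\<bar> \<le> 1"
proof -
  let ?v = "(x \<bullet> x - R\<^sup>2) / (R * w)"
  have "?v\<^sup>2 < 1"
  proof (rule ccontr)
    assume "\<not> ?v\<^sup>2 < 1"
    then have "max 0 (1 - ?v\<^sup>2) = 0" by linarith
    then show False using nz unfolding ring_bump_def ring_bump_slope_def by simp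
  qed
  then have v: "\<bar>?v\<bar> < 1" by (rule abs_square_less_1[THEN iffD1])
  then show "\<bar>?v\<bar> \<le> 1" by linarith
  have Rw: "0 < R * w" using w by simp
  then have "\<bar>?v\<bar> = \<bar>x \<bullet> x - R\<^sup>2\<bar> / (R * w)" by (simp only: abs_divide abs_of_pos)
  then have "\<bar>x \<bullet> x - R\<^sup>2\<bar> = \<bar>?v\<bar> * (R * w)"
    using Rw by (metis less_irrefl nonzero_eq_divide_eq)
  also have "\<dots> < 1 * (R * w)" using v Rw by (rule mult_strict_right_mono)
  finally have "\<bar>x \<bullet> x - R\<^sup>2\<bar> < R * w" by simp
  then have x: "(norm x)\<^sup>2 < R\<^sup>2 + R * w" "R\<^sup>2 - R * w < (norm x)\<^sup>2"
    by (simp_all add: power2_norm_eq_inner)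
  have ww: "0 < w * w" "w * w \<le> R * w" using w by simp_all
  have "R\<^sup>2 + R * w \<le> (R + w)\<^sup>2"
    using Rw ww(1) unfolding power2_eq_square distrib_left distrib_right by (simp add: mult.commute)
  then have "(norm x)\<^sup>2 < (R + w)\<^sup>2" using x(1) by linarith
  then have "norm x < R + w"
    using w by (intro power2_less_imp_less[of "norm x" "R + w"]) simp_all
  moreover have "(R - w)\<^sup>2 \<le> R\<^sup>2 - R * w"
    using ww(2) unfolding power2_eq_square left_diff_distrib right_diff_distrib by (simp add: mult.commute)
  then have "(R - w)\<^sup>2 < (norm x)\<^sup>2" using x(2) by linarith
  then have "R - w < norm x"
    by (rule power2_less_imp_less) simp
  ultimately show "x \<in> ball 0 (R + w) - ball 0 (R - w)" by auto
qed

lemma norm_gradient_ring_bump_le: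
  fixes x :: "real ^ 'n::finite"
  assumes w: "0 < w" "w \<le> R"
  shows "norm (\<chi> i. pdiff i (ring_bump R w) x) \<le> 16 / w * indicator (ball 0 (R + w) - ball 0 (R - w)) x"
proof -
  have eq: "(\<chi> i. pdiff i (ring_bump R w) x) = ring_bump_slope R w x *\<^sub>R x"
    by (simp add: pdiff_ring_bump vec_eq_iff)
  show ?thesis
  proof (cases "ring_bump_slope R w x = 0")
    case True
    then show ?thesis unfolding eq using w by simp
  next
    case False
    let ?v = "(x \<bullet> x - R\<^sup>2) / (R * w)"
    note nz = ring_bump_support[OF w disjI2[OF False]]
    have "\<bar>ring_bump_slope R w x\<bar> = 8 * max 0 (1 - ?v\<^sup>2) * \<bar>?v\<bar> / (R * w)"
      unfolding ring_bump_slope_def using w by (simp add: abs_mult)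
    also have "\<dots> \<le> 8 * 1 * 1 / (R * w)"
      using nz(2) w by (intro divide_right_mono mult_mono) auto
    finally have "\<bar>ring_bump_slope R w x\<bar> \<le> 8 / (R * w)" by simp
    moreover have "norm x \<le> 2 * R" using nz(1) w by simp
    ultimately have "\<bar>ring_bump_slope R w x\<bar> * norm x \<le> 8 / (R * w) * (2 * R)"
      using w by (intro mult_mono) auto
    also have "\<dots> = 16 / w" using w by simp
    finally show ?thesis unfolding eq using nz(1) by simp
  qed
qed

lemma ring_bump_ge_half:
  fixes x :: "real ^ 'n::finite"
  assumes w: "0 < w" "w \<le> R" and x: "x \<in> ball 0 (R + w / 8) - ball 0 R"
  shows "1 / 2 \<le> ring_bump R w x"
proof -
  let ?v = "(x \<bullet> x - R\<^sup>2) / (R * w)"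
  have n: "R \<le> norm x" "norm x \<le> R + w / 8" using x by auto
  have ww: "0 < R * w" "w * w \<le> R * w" using w by simp_all
  have "x \<bullet> x \<le> (R + w / 8)\<^sup>2"
    unfolding power2_norm_eq_inner[symmetric] using n by (intro power_mono) auto
  also have "\<dots> \<le> R\<^sup>2 + R * w / 2"
    using ww by (simp add: power2_eq_square algebra_simps)
  finally have "?v \<le> 1 / 2" using w by (simp add: field_simps)
  moreover have "R\<^sup>2 \<le> x \<bullet> x"
    unfolding power2_norm_eq_inner[symmetric] using n w by (intro power_mono) auto
  then have "0 \<le> ?v" using w by simp
  ultimately have "?v\<^sup>2 \<le> (1 / 2)\<^sup>2" by (intro power_mono) auto
  moreover have "(1 / 2 :: real)\<^sup>2 = 1 / 4" by (simp add: power2_eq_square)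
  ultimately have "3 / 4 \<le> max 0 (1 - ?v\<^sup>2)" by linarith
  then have "(3 / 4)\<^sup>2 \<le> ring_bump R w x"
    unfolding ring_bump_def by (rule power_mono) simp
  moreover have "1 / 2 \<le> (3 / 4 :: real)\<^sup>2" by (simp add: power2_eq_square)
  ultimately show ?thesis by linarith
qed

lemma radially_symmetric_ring_bump: "radially_symmetric (ring_bump R w)"
  unfolding radially_symmetric_def ring_bump_def
  by (intro exI[of _ "\<lambda>r. (max 0 (1 - ((r\<^sup>2 - R\<^sup>2) / (R * w))\<^sup>2))\<^sup>2"] AE_I2) (simp add: power2_norm_eq_inner)

section \<open>Norm estimates\<close>

lemma ennpowr_ennreal: "0 \<le> x \<Longrightarrow> ennpowr (ennreal x) a = ennreal (x powr a)"
  by (simp add: ennpowr_def)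

lemma ennpowr_mono:
  assumes "x \<le> y" "0 \<le> a"
  shows "ennpowr x a \<le> ennpowr y a"
proof (cases "y = \<infinity>")
  case False
  then have "x \<noteq> \<infinity>" using assms(1) by (auto simp: top_unique)
  moreover have "enn2real x \<le> enn2real y"
    using assms(1) False by (intro enn2real_mono) (auto simp: top.not_eq_extremum)
  ultimately show ?thesis
    using False assms(2) by (auto simp: ennpowr_def intro!: ennreal_leI powr_mono2)
qed (simp add: ennpowr_def)

lemma nn_integral_le_of_indicator:
  assumes "\<And>x. f x \<le> c * indicator A x" "A \<in> sets M"
  shows "(\<integral>\<^sup>+x. f x \<partial>M) \<le> c * emeasure M A"
  using nn_integral_mono[of M f "\<lambda>x. c * indicator A x"] assms by (simp add: nn_integral_cmult_indicator)

lemma nn_integral_powr_atLeast: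
  assumes "1 < b" "0 < r"
  shows "(\<integral>\<^sup>+\<rho>. ennreal (\<rho> powr (- b)) * indicator {r..} \<rho> \<partial>lebesgue) = ennreal (r powr (1 - b) / (b - 1))"
proof -
  have "(\<integral>\<^sup>+\<rho>. ennreal (\<rho> powr (- b)) * indicator {r..} \<rho> \<partial>lborel)
      = ennreal (0 - (- (r powr (1 - b) / (b - 1))))"
  proof (rule nn_integral_FTC_atLeast)
    fix x assume "r \<le> x"
    with assms have "((\<lambda>x. x powr (1 - b)) has_real_derivative (1 - b) * x powr (1 - b - 1)) (at x)"
      by (intro has_real_derivative_powr) simp
    then have "((\<lambda>x. - (x powr (1 - b) / (b - 1))) has_real_derivative
        - ((1 - b) * x powr (1 - b - 1) / (b - 1))) (at x)"
      by (intro DERIV_minus DERIV_cdivide)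
    moreover have "- ((1 - b) * y / (b - 1)) = y" for y
      using assms nonzero_mult_div_cancel_left[of "b - 1" y] by (metis diff_gt_0_iff_gt less_irrefl minus_diff_eq minus_divide_left minus_mult_left)
    ultimately show "((\<lambda>x. - (x powr (1 - b) / (b - 1))) has_real_derivative x powr - b) (at x)"
      by simp
  next
    have "((\<lambda>x::real. x powr (1 - b)) \<longlongrightarrow> 0) at_top"
      using assms by (intro tendsto_neg_powr filterlim_ident) simp
    then have "((\<lambda>x::real. - (x powr (1 - b) / (b - 1))) \<longlongrightarrow> - (0 / (b - 1))) at_top"
      using assms by (intro tendsto_intros) auto
    then show "((\<lambda>x::real. - (x powr (1 - b) / (b - 1))) \<longlongrightarrow> 0) at_top" by simp
  qed auto
  then show ?thesis by (simp add: nn_integral_completion)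
qed

text \<open>The annulus in \<open>ex_annulus_lower_bound\<close> is part of the one in \<open>ex_annulus_upper_bound\<close>. Both volumes
  are of order \<open>R ^ (N - 1) * w\<close>; on the smaller annulus the bump is at least \<open>1 / 2\<close> (\<open>ring_bump_ge_half\<close>).\<close>

lemma ex_annulus_upper_bound:
  "\<exists>K>0. \<forall>R w. 0 < w \<and> w \<le> R / 2 \<longrightarrow>
     emeasure lebesgue (ball (0::real ^ 'n::finite) (R + w) - ball 0 (R - w))
       \<le> ennreal (K * (R ^ (CARD('n) - 1) * w))"
proof (intro exI conjI allI impI)
  let ?\<kappa> = "measure lborel (ball (0::real ^ 'n) 1)" and ?N = "CARD('n)"
  have \<kappa>: "0 < ?\<kappa>" by (rule content_ball_pos) simp
  then show "0 < ?\<kappa> * (real ?N * (2 * 2 ^ (?N - 1)))" by simp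
  fix R w :: real assume w: "0 < w \<and> w \<le> R / 2"
  have "(R + w) ^ ?N - (R - w) ^ ?N \<le> real ?N * ((R + w) - (R - w)) * (R + w) ^ (?N - 1)"
    by (rule power_diff_bounds(1)) (use w in auto)
  also have "\<dots> = real ?N * (2 * w) * (R + w) ^ (?N - 1)" by simp
  also have "\<dots> \<le> real ?N * (2 * w) * (2 * R) ^ (?N - 1)"
    using w by (intro mult_left_mono power_mono) auto
  also have "\<dots> = real ?N * (2 * 2 ^ (?N - 1)) * (R ^ (?N - 1) * w)"
    by (simp add: power_mult_distrib)
  finally have "?\<kappa> * ((R + w) ^ ?N - (R - w) ^ ?N)
      \<le> ?\<kappa> * (real ?N * (2 * 2 ^ (?N - 1)) * (R ^ (?N - 1) * w))"
    using \<kappa> by (intro mult_left_mono) auto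
  moreover have "emeasure lebesgue (ball (0::real ^ 'n) (R + w) - ball 0 (R - w))
      = ennreal (?\<kappa> * ((R + w) ^ ?N - (R - w) ^ ?N))"
    using w by (intro emeasure_annulus) auto
  ultimately show "emeasure lebesgue (ball (0::real ^ 'n) (R + w) - ball 0 (R - w))
       \<le> ennreal (?\<kappa> * (real ?N * (2 * 2 ^ (?N - 1))) * (R ^ (?N - 1) * w))"
    by (simp only: mult.assoc) (intro ennreal_leI, simp add: mult.assoc)
qed

lemma ex_annulus_lower_bound:
  "\<exists>k>0. \<forall>R w. 0 < w \<and> 0 < R \<longrightarrow>
     ennreal (k * (R ^ (CARD('n) - 1) * w))
       \<le> emeasure lebesgue (ball (0::real ^ 'n::finite) (R + w / 8) - ball 0 R)"
proof (intro exI conjI allI impI)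
  let ?\<kappa> = "measure lborel (ball (0::real ^ 'n) 1)" and ?N = "CARD('n)"
  have \<kappa>: "0 < ?\<kappa>" by (rule content_ball_pos) simp
  then show "0 < ?\<kappa> * (real ?N / 8)" by simp
  fix R w :: real assume w: "0 < w \<and> 0 < R"
  have "real ?N * ((R + w / 8) - R) * R ^ (?N - 1) \<le> (R + w / 8) ^ ?N - R ^ ?N"
    by (rule power_diff_bounds(2)) (use w in auto)
  moreover have "real ?N * ((R + w / 8) - R) * R ^ (?N - 1) = (real ?N / 8) * (R ^ (?N - 1) * w)"
    by simp
  ultimately have "(real ?N / 8) * (R ^ (?N - 1) * w) \<le> (R + w / 8) ^ ?N - R ^ ?N"
    by (simp only:)
  then have "?\<kappa> * ((real ?N / 8) * (R ^ (?N - 1) * w)) \<le> ?\<kappa> * ((R + w / 8) ^ ?N - R ^ ?N)"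
    using \<kappa> by (intro mult_left_mono) auto
  moreover have "emeasure lebesgue (ball (0::real ^ 'n) (R + w / 8) - ball 0 R)
      = ennreal (?\<kappa> * ((R + w / 8) ^ ?N - R ^ ?N))"
    using w by (intro emeasure_annulus) auto
  ultimately show "ennreal (?\<kappa> * (real ?N / 8) * (R ^ (?N - 1) * w))
      \<le> emeasure lebesgue (ball (0::real ^ 'n) (R + w / 8) - ball 0 R)"
    by (simp only: mult.assoc) (intro ennreal_leI, simp only: mult.assoc)
qed

lemma L2_weak_gradient_ring_bump_le:
  assumes w: "0 < w" "w \<le> R" and M: "0 \<le> M"
    and A: "emeasure lebesgue (ball (0::real ^ 'n::finite) (R + w) - ball 0 (R - w)) \<le> ennreal M"
  shows "L_norm 2 (weak_gradient (ring_bump R w :: real ^ 'n \<Rightarrow> real)) \<le> ennreal ((256 * M / w\<^sup>2) powr (1 / 2))"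
proof -
  let ?u = "ring_bump R w :: real ^ 'n \<Rightarrow> real"
  let ?A = "ball (0::real ^ 'n) (R + w) - ball 0 (R - w)"
  have "(\<integral>\<^sup>+x. ennreal (norm (weak_gradient ?u x) powr 2) \<partial>lebesgue)
      = (\<integral>\<^sup>+x. ennreal (norm (\<chi> i. pdiff i ?u x) powr 2) \<partial>lebesgue)"
    using weak_gradient_C1_AE[OF ring_bump_C1, of R w] by (intro nn_integral_cong_AE) auto
  also have "\<dots> \<le> ennreal ((16 / w)\<^sup>2) * emeasure lebesgue ?A"
  proof (rule nn_integral_le_of_indicator)
    fix x :: "real ^ 'n"
    have "norm (\<chi> i. pdiff i ?u x) powr 2 = (norm (\<chi> i. pdiff i ?u x))\<^sup>2"
      by (simp add: powr_numeral)
    also have "\<dots> \<le> (16 / w * indicator ?A x)\<^sup>2"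
      by (intro power_mono norm_gradient_ring_bump_le w) simp
    also have "\<dots> = (16 / w)\<^sup>2 * indicator ?A x"
      by (simp add: indicator_def)
    finally have "ennreal (norm (\<chi> i. pdiff i ?u x) powr 2) \<le> ennreal ((16 / w)\<^sup>2 * indicator ?A x)"
      by (rule ennreal_leI)
    also have "\<dots> = ennreal ((16 / w)\<^sup>2) * indicator ?A x"
      by (simp add: indicator_def)
    finally show "ennreal (norm (\<chi> i. pdiff i ?u x) powr 2) \<le> ennreal ((16 / w)\<^sup>2) * indicator ?A x" .
  qed auto
  also have "\<dots> \<le> ennreal ((16 / w)\<^sup>2) * ennreal M"
    by (intro mult_left_mono A) simp
  also have "\<dots> = ennreal ((16 / w)\<^sup>2 * M)" using M by (simp add: ennreal_mult)
  also have "(16 / w)\<^sup>2 * M = 256 * M / w\<^sup>2" by (simp add: power_divide)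
  finally have "L_norm 2 (weak_gradient ?u) \<le> ennpowr (ennreal (256 * M / w\<^sup>2)) (1 / 2)"
    unfolding L_norm_def by (intro ennpowr_mono) auto
  also have "\<dots> = ennreal ((256 * M / w\<^sup>2) powr (1 / 2))"
    using M by (intro ennpowr_ennreal) simp
  finally show ?thesis .
qed

lemma Lpqb_norm_ring_bump_le:
  assumes w: "0 < w" "w \<le> R / 2" and M: "0 \<le> M" and pqb: "0 < p" "0 < q" "1 < b"
    and A: "emeasure lebesgue (ball (0::real ^ 'n::finite) (R + w) - ball 0 (R - w)) \<le> ennreal M"
  shows "Lpqb_norm p q b (ring_bump R w :: real ^ 'n \<Rightarrow> real)
    \<le> ennreal ((M powr q * ((R / 2) powr (1 - b) / (b - 1))) powr (1 / (p * q)))"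
proof -
  let ?u = "ring_bump R w :: real ^ 'n \<Rightarrow> real"
  let ?A = "ball (0::real ^ 'n) (R + w) - ball 0 (R - w)"
  have R: "0 < R" "w \<le> R" using w by auto
  have mass: "ennpowr (ball_mass p ?u \<rho>) q \<le> ennreal (M powr q) * indicator {R / 2..} \<rho>" for \<rho>
  proof (cases "R / 2 \<le> \<rho>")
    case True
    have "ball_mass p ?u \<rho> \<le> 1 * emeasure lebesgue ?A"
      unfolding ball_mass_def
    proof (rule nn_integral_le_of_indicator)
      fix x :: "real ^ 'n"
      have "\<bar>?u x\<bar> powr p \<le> 1"
        using ring_bump_bounds[of R w x] pqb by (simp add: powr_le1)
      moreover have "\<bar>?u x\<bar> powr p = 0" if "x \<notin> ?A"
        using ring_bump_support(1)[of w R x] w(1) R that by auto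
      ultimately show "ennreal (\<bar>?u x\<bar> powr p) * indicator (ball 0 \<rho>) x \<le> 1 * indicator ?A x"
        by (auto simp: indicator_def)
    qed auto
    also have "\<dots> \<le> ennreal M" using A by simp
    finally have "ennpowr (ball_mass p ?u \<rho>) q \<le> ennpowr (ennreal M) q"
      using pqb by (intro ennpowr_mono) auto
    then show ?thesis using True M by (simp add: ennpowr_ennreal)
  next
    case False
    have "ennreal (\<bar>?u x\<bar> powr p) * indicator (ball 0 \<rho>) x = 0" for x
      using ring_bump_support(1)[of w R x] w R False by (auto simp: indicator_def)
    then have "ball_mass p ?u \<rho> = 0" unfolding ball_mass_def by (simp only: nn_integral_const mult_zero_left)
    then show ?thesis by (simp add: ennpowr_def)
  qed
  have "(\<integral>\<^sup>+\<rho>\<in>{0<..}. ennreal (\<rho> powr (- b)) * ennpowr (ball_mass p ?u \<rho>) q \<partial>lebesgue)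
      \<le> (\<integral>\<^sup>+\<rho>. ennreal (M powr q) * (ennreal (\<rho> powr (- b)) * indicator {R / 2..} \<rho>) \<partial>lebesgue)"
  proof (rule nn_integral_mono)
    fix \<rho> :: real
    have "ennreal (\<rho> powr (- b)) * ennpowr (ball_mass p ?u \<rho>) q * indicator {0<..} \<rho>
        \<le> ennreal (\<rho> powr (- b)) * (ennreal (M powr q) * indicator {R / 2..} \<rho>) * 1"
      by (intro mult_mono mass) (auto simp: indicator_def)
    then show "ennreal (\<rho> powr (- b)) * ennpowr (ball_mass p ?u \<rho>) q * indicator {0<..} \<rho>
        \<le> ennreal (M powr q) * (ennreal (\<rho> powr (- b)) * indicator {R / 2..} \<rho>)"
      by (simp add: ac_simps)
  qed
  also have "\<dots> = ennreal (M powr q) * ennreal ((R / 2) powr (1 - b) / (b - 1))"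
    using R pqb by (subst nn_integral_cmult) (auto simp: nn_integral_powr_atLeast intro!: measurable_completion)
  also have "\<dots> = ennreal (M powr q * ((R / 2) powr (1 - b) / (b - 1)))"
    using pqb by (intro ennreal_mult[symmetric]) auto
  finally have "Lpqb_norm p q b ?u
      \<le> ennpowr (ennreal (M powr q * ((R / 2) powr (1 - b) / (b - 1)))) (1 / (p * q))"
    unfolding Lpqb_norm_def using pqb by (intro ennpowr_mono) auto
  also have "\<dots> = ennreal ((M powr q * ((R / 2) powr (1 - b) / (b - 1))) powr (1 / (p * q)))"
    using pqb by (intro ennpowr_ennreal) auto
  finally show ?thesis .
qed

lemma L_norm_ring_bump_ge:
  assumes w: "0 < w" "w \<le> R" and m: "0 \<le> m" and s: "0 < s"
    and B: "ennreal m \<le> emeasure lebesgue (ball (0::real ^ 'n::finite) (R + w / 8) - ball 0 R)"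
  shows "ennreal (((1 / 2) powr s * m) powr (1 / s)) \<le> L_norm s (ring_bump R w :: real ^ 'n \<Rightarrow> real)"
proof -
  let ?u = "ring_bump R w :: real ^ 'n \<Rightarrow> real"
  let ?B = "ball (0::real ^ 'n) (R + w / 8) - ball 0 R"
  have "ennreal ((1 / 2) powr s * m) = ennreal ((1 / 2) powr s) * ennreal m"
    using m by (intro ennreal_mult) auto
  also have "\<dots> \<le> ennreal ((1 / 2) powr s) * emeasure lebesgue ?B"
    by (intro mult_left_mono B) simp
  also have "\<dots> = (\<integral>\<^sup>+x. ennreal ((1 / 2) powr s) * indicator ?B x \<partial>lebesgue)"
    by (rule nn_integral_cmult_indicator[symmetric]) auto
  also have "\<dots> \<le> (\<integral>\<^sup>+x. ennreal (norm (?u x) powr s) \<partial>lebesgue)"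
  proof (rule nn_integral_mono)
    fix x :: "real ^ 'n"
    have "(1 / 2) powr s \<le> norm (?u x) powr s" if "x \<in> ?B"
      using ring_bump_ge_half[OF w that] s by (intro powr_mono2) auto
    then show "ennreal ((1 / 2) powr s) * indicator ?B x \<le> ennreal (norm (?u x) powr s)"
      by (auto simp: indicator_def intro!: ennreal_leI)
  qed
  finally have "ennpowr (ennreal ((1 / 2) powr s * m)) (1 / s) \<le> L_norm s ?u"
    unfolding L_norm_def using s by (intro ennpowr_mono) auto
  then show ?thesis using m by (simp add: ennpowr_ennreal)
qed

lemma E_norm_le:
  assumes "0 < p" "0 < q" "0 \<le> X" "0 \<le> Y" "0 \<le> t"
    and "L_norm 2 (weak_gradient u) \<le> ennreal (X * t)" "Lpqb_norm p q b u \<le> ennreal (Y * t)"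
  shows "E_norm p q b u \<le> ennreal ((X powr (2 * p * q) + Y powr (2 * p * q)) powr (1 / (2 * p * q)) * t)"
proof -
  let ?P = "2 * p * q"
  have P: "0 < ?P" using assms by simp
  have "ennpowr (L_norm 2 (weak_gradient u)) ?P + ennpowr (Lpqb_norm p q b u) ?P
      \<le> ennpowr (ennreal (X * t)) ?P + ennpowr (ennreal (Y * t)) ?P"
    using assms P by (intro add_mono ennpowr_mono) auto
  also have "\<dots> = ennreal ((X powr ?P + Y powr ?P) * t powr ?P)"
    using assms by (simp add: ennpowr_ennreal powr_mult distrib_right flip: ennreal_plus)
  finally have "E_norm p q b u \<le> ennpowr (ennreal ((X powr ?P + Y powr ?P) * t powr ?P)) (1 / ?P)"
    unfolding E_norm_def using P by (intro ennpowr_mono) auto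
  also have "\<dots> = ennreal ((X powr ?P + Y powr ?P) powr (1 / ?P) * (t powr ?P) powr (1 / ?P))"
    by (simp add: ennpowr_ennreal powr_mult)
  also have "(t powr ?P) powr (1 / ?P) = t"
    using P assms by (simp add: powr_powr)
  finally show ?thesis .
qed

section \<open>The critical width\<close>

text \<open>
  The exponent \<open>a\<close> for which bumps of width \<open>R powr a\<close> at radius \<open>R\<close> make the bounds on the two parts of the
  norm of \<open>E\<close> the same power of \<open>R\<close>. It may be negative.
\<close>

definition critical_width :: "nat \<Rightarrow> real \<Rightarrow> real \<Rightarrow> real \<Rightarrow> real" where
  "critical_width N p q b = (2 * (b - 1) + (real N - 1) * q * (p - 2)) / (q * (p + 2))"

text \<open>
  The second conclusion equates the exponents of \<open>R\<close> in the bounds on the two parts of the norm. The third one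
  compares this common exponent with that of the \<open>L\<^sup>s\<close> norm; they agree when \<open>s\<close> is the critical exponent.
\<close>

lemma critical_width_exponents:
  fixes p q b s :: real and N :: nat
  defines "a \<equiv> critical_width N p q b"
  assumes N: "2 \<le> N" and p: "1 < p" "1 \<le> q" and b: "1 < b" "b < b_star N p q"
  shows "a < 1"
    and "(q * (real N - 1 + a) + 1 - b) / (p * q) = (real N - 1 - a) / 2"
    and "s < two_star_pqb N p q b \<Longrightarrow> 0 < s \<Longrightarrow> (real N - 1 - a) / 2 < (real N - 1 + a) / s"
proof -
  have qp: "0 < q * (p + 2)" using p by simp
  \<comment> \<open>This is \<open>b < b\<^sub>*\<close> in a form that covers both \<open>N = 2\<close> and \<open>N \<ge> 3\<close>.\<close>
  have bs: "2 * (b - 1) < q * (2 * real N - p * (real N - 2))"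
  proof (cases "N = 2")
    case True
    then show ?thesis using b(2) by (simp add: b_star_def)
  next
    case False
    then have "real N - 2 > 0" using N by simp
    then have "b_star N p q = 1 + q * (2 * real N - p * (real N - 2)) / 2"
      using False by (simp add: b_star_def two_star_def field_simps)
    then show ?thesis using b(2) by simp
  qed
  have "2 * (b - 1) + (real N - 1) * q * (p - 2) < q * (p + 2)"
    using bs by (simp add: algebra_simps)
  then show "a < 1"
    unfolding a_def critical_width_def using qp by simp
  have aqp: "a * (q * (p + 2)) = 2 * (b - 1) + (real N - 1) * q * (p - 2)"
    unfolding a_def critical_width_def using qp by (metis less_irrefl nonzero_eq_divide_eq)
  have "2 * (q * (real N - 1 + a) + 1 - b) = (real N - 1 - a) * (p * q)"
    using aqp by (simp add: algebra_simps)
  then show "(q * (real N - 1 + a) + 1 - b) / (p * q) = (real N - 1 - a) / 2"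
    using p by (simp add: field_simps)
  assume s: "s < two_star_pqb N p q b" "0 < s"
  let ?den = "2 * (real N - 1) * q + 1 - b"
  have "0 \<le> q * (p * (real N - 2))" "0 \<le> q * (real N - 2)" using N p by auto
  then have den: "0 < ?den" using bs by (simp add: algebra_simps)
  have num: "(real N - 1 + a) * (q * (p + 2)) = 2 * ((real N - 1) * p * q + b - 1)"
    "(real N - 1 - a) * (q * (p + 2)) = 2 * ?den"
    using aqp by (simp_all add: algebra_simps)
  have "s * ?den < 2 * ((real N - 1) * p * q + b - 1)"
    using s den unfolding two_star_pqb_def by (simp add: pos_less_divide_eq)
  then have "(s * (real N - 1 - a)) * (q * (p + 2)) < (2 * (real N - 1 + a)) * (q * (p + 2))"
    using num by (simp only: mult.assoc)
  then have "s * (real N - 1 - a) < 2 * (real N - 1 + a)"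
    using qp by (rule mult_right_less_imp_less[OF _ less_imp_le])
  then show "(real N - 1 - a) / 2 < (real N - 1 + a) / s"
    using s by (simp add: field_simps)
qed

text \<open>
  The constants do not depend on \<open>R\<close>, and \<open>R powr a \<le> R / 2\<close> holds for all large \<open>R\<close> because \<open>a < 1\<close>.
\<close>

lemma ring_bump_family:
  fixes p q b :: real
  defines "a \<equiv> critical_width (CARD('n::finite)) p q b"
  defines "e \<equiv> (real (CARD('n)) - 1 - a) / 2"
  assumes N: "2 \<le> CARD('n)" and p: "1 < p" "1 \<le> q" and b: "1 < b" "b < b_star (CARD('n)) p q" and s: "0 < s"
  shows "\<exists>c>0. \<exists>c'>0. \<forall>R. 0 < R \<and> R powr a \<le> R / 2 \<longrightarrow>
    (let u = ring_bump R (R powr a) :: real ^ 'n \<Rightarrow> real in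
       u \<in> E_rad_space p q b \<and>
       E_norm p q b u \<le> ennreal (c' * R powr e) \<and>
       ennreal (c * R powr ((real (CARD('n)) - 1 + a) / s)) \<le> L_norm s u)"
proof -
  let ?D = "real (CARD('n)) - 1"
  note ex = critical_width_exponents(2)[OF N p b, folded a_def]
  obtain K where K: "0 < K" and upper: "\<And>R w. 0 < w \<Longrightarrow> w \<le> R / 2 \<Longrightarrow>
     emeasure lebesgue (ball (0::real ^ 'n) (R + w) - ball 0 (R - w)) \<le> ennreal (K * (R ^ (CARD('n) - 1) * w))"
    using ex_annulus_upper_bound by blast
  obtain k where k: "0 < k" and lower: "\<And>R w. 0 < w \<Longrightarrow> 0 < R \<Longrightarrow>
     ennreal (k * (R ^ (CARD('n) - 1) * w)) \<le> emeasure lebesgue (ball (0::real ^ 'n) (R + w / 8) - ball 0 R)"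
    using ex_annulus_lower_bound by blast
  define X where "X = (256 * K) powr (1 / 2)"
  define Y where "Y = (K powr q * ((1 / 2) powr (1 - b) / (b - 1))) powr (1 / (p * q))"
  define c' where "c' = (X powr (2 * p * q) + Y powr (2 * p * q)) powr (1 / (2 * p * q))"
  define c where "c = ((1 / 2) powr s * k) powr (1 / s)"
  have "0 < X" using K by (simp add: X_def)
  moreover have "0 < Y" using K b by (simp add: Y_def)
  ultimately have "0 < X powr (2 * p * q) + Y powr (2 * p * q)"
    by (intro add_pos_pos) simp_all
  then have XY: "0 \<le> X" "0 \<le> Y" "0 < c'" by (simp_all add: X_def Y_def c'_def)
  have c: "0 < c" using k by (simp add: c_def)
  have "u \<in> E_rad_space p q b \<and> E_norm p q b u \<le> ennreal (c' * R powr e) \<and>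
       ennreal (c * R powr ((?D + a) / s)) \<le> L_norm s u"
    if R: "0 < R" "R powr a \<le> R / 2" and u: "u = (ring_bump R (R powr a) :: real ^ 'n \<Rightarrow> real)" for R u
  proof -
    let ?w = "R powr a"
    have w: "0 < ?w" "?w \<le> R / 2" "?w \<le> R" using R by auto
    have vol: "R ^ (CARD('n) - 1) * ?w = R powr (?D + a)"
      using R N by (simp add: powr_add of_nat_diff flip: powr_realpow)
    have M: "0 \<le> K * R powr (?D + a)" "0 \<le> k * R powr (?D + a)" using K k by auto
    have "L_norm 2 (weak_gradient u) \<le> ennreal ((256 * (K * R powr (?D + a)) / ?w\<^sup>2) powr (1 / 2))"
      unfolding u using upper[OF w(1,2)] unfolding vol by (rule L2_weak_gradient_ring_bump_le[OF w(1,3) M(1)])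
    also have "256 * (K * R powr (?D + a)) / ?w\<^sup>2 = (256 * K) * R powr (?D - a)"
      using R by (simp add: powr_diff powr_add power2_eq_square field_simps)
    also have "\<dots> powr (1 / 2) = X * R powr e"
      using R K by (simp add: X_def e_def powr_mult powr_powr)
    finally have X: "L_norm 2 (weak_gradient u) \<le> ennreal (X * R powr e)" .
    have "Lpqb_norm p q b u
        \<le> ennreal (((K * R powr (?D + a)) powr q * ((R / 2) powr (1 - b) / (b - 1))) powr (1 / (p * q)))"
      unfolding u using upper[OF w(1,2)] unfolding vol
      by (rule Lpqb_norm_ring_bump_le[OF w(1,2) M(1), rotated 3]) (use p b in auto)
    also have "(K * R powr (?D + a)) powr q * ((R / 2) powr (1 - b) / (b - 1))
        = (K powr q * ((1 / 2) powr (1 - b) / (b - 1))) * R powr (q * (?D + a) + 1 - b)"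
    proof -
      have "(R / 2) powr (1 - b) = R powr (1 - b) * (1 / 2) powr (1 - b)"
        using R by (simp add: powr_divide)
      moreover have "(K * R powr (?D + a)) powr q = K powr q * R powr (q * (?D + a))"
        using R K by (simp add: powr_mult powr_powr mult.commute)
      moreover have "R powr (q * (?D + a) + 1 - b) = R powr (q * (?D + a)) * R powr (1 - b)"
        by (simp flip: powr_add add: add_diff_eq)
      ultimately show ?thesis by simp
    qed
    also have "\<dots> powr (1 / (p * q)) = Y * R powr ((q * (?D + a) + 1 - b) / (p * q))"
      unfolding Y_def powr_mult[of "K powr q * ((1 / 2) powr (1 - b) / (b - 1))"]
      by (simp add: powr_powr)
    also have "\<dots> = Y * R powr e" by (simp only: ex e_def)
    finally have Y: "Lpqb_norm p q b u \<le> ennreal (Y * R powr e)" .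
    have "E_norm p q b u \<le> ennreal (c' * R powr e)"
      unfolding c'_def by (rule E_norm_le) (use p XY X Y in auto)
    moreover have "u \<in> E_rad_space p q b"
    proof -
      have "weakly_differentiable u"
        unfolding weakly_differentiable_def u using C1_has_weak_gradient[OF ring_bump_C1] by blast
      moreover have "L_norm 2 (weak_gradient u) + Lpqb_norm p q b u < \<infinity>"
        using le_less_trans[OF X ennreal_less_top] le_less_trans[OF Y ennreal_less_top] by simp
      ultimately show ?thesis
        by (simp add: E_rad_space_def E_space_def u radially_symmetric_ring_bump)
    qed
    moreover have "ennreal (c * R powr ((?D + a) / s)) \<le> L_norm s u"
    proof -
      have "ennreal (((1 / 2) powr s * (k * R powr (?D + a))) powr (1 / s)) \<le> L_norm s u"
        unfolding u using lower[OF w(1) R(1)] unfolding vol by (rule L_norm_ring_bump_ge[OF w(1,3) M(2) s])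
      also have "((1 / 2) powr s * (k * R powr (?D + a))) powr (1 / s) = c * R powr ((?D + a) / s)"
        using k R by (simp add: c_def powr_mult powr_powr)
      finally show ?thesis .
    qed
    ultimately show ?thesis by blast
  qed
  then show ?thesis
    unfolding Let_def using c XY(3) by blast
qed

theorem theorem2p12:
  fixes p q b :: real
  assumes "CARD('n::finite) \<ge> 2"
    and "1 < p" and "CARD('n) \<ge> 3 \<Longrightarrow> p < two_star (CARD('n))"
    and "1 \<le> q" and "p * q > 2"
    and "1 < b" and "b < b_star (CARD('n)) p q"
  shows "\<forall>s. 1 \<le> s \<and> s < two_star_pqb (CARD('n)) p q b \<longrightarrow>
           \<not> E_rad_embedded_in_L TYPE('n) p q b s"
proof (intro allI impI)
  fix s assume s: "1 \<le> s \<and> s < two_star_pqb (CARD('n)) p q b"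
  define a where "a = critical_width (CARD('n)) p q b"
  let ?e = "(real (CARD('n)) - 1 - a) / 2" and ?f = "(real (CARD('n)) - 1 + a) / s"
  note hyps = assms(1,2,4,6,7)
  have a: "a < 1" and ef: "?e < ?f"
    using critical_width_exponents(1,3)[OF hyps, folded a_def] s by auto
  obtain c c' where c: "0 < c" "0 < c'" and
    fam: "\<And>R. 0 < R \<Longrightarrow> R powr a \<le> R / 2 \<Longrightarrow>
      (let u = ring_bump R (R powr a) :: real ^ 'n \<Rightarrow> real in
       u \<in> E_rad_space p q b \<and> E_norm p q b u \<le> ennreal (c' * R powr ?e) \<and>
       ennreal (c * R powr ?f) \<le> L_norm s u)"
    using ring_bump_family[OF hyps, of s, folded a_def] s by auto
  show "\<not> E_rad_embedded_in_L TYPE('n) p q b s"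
  proof
    assume "E_rad_embedded_in_L TYPE('n) p q b s"
    then obtain C where C: "0 < C" and
      emb: "\<And>u::real ^ 'n \<Rightarrow> real. u \<in> E_rad_space p q b \<Longrightarrow> L_norm s u \<le> ennreal C * E_norm p q b u"
      unfolding E_rad_embedded_in_L_def by blast
    have pow: "filterlim (\<lambda>R::real. R powr t) at_top at_top" if "0 < t" for t
    proof (rule filterlim_cong[OF refl refl, THEN iffD1])
      show "filterlim (\<lambda>R. exp (t * ln R)) at_top at_top"
        by (rule filterlim_compose[OF exp_at_top
              filterlim_tendsto_pos_mult_at_top[OF tendsto_const that ln_at_top]])
      show "\<forall>\<^sub>F R in at_top. exp (t * ln R) = R powr t"
        using eventually_gt_at_top[of "0::real"] by eventually_elim (simp add: powr_def)
    qed
    have "\<forall>\<^sub>F R in at_top. 0 < R \<and> 2 \<le> R powr (1 - a) \<and> C * c' / c < R powr (?f - ?e)"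
      using pow[of "1 - a", unfolded filterlim_at_top] pow[of "?f - ?e", unfolded filterlim_at_top_dense] a ef
      by (intro eventually_conj eventually_gt_at_top) simp_all
    then obtain R :: real where R: "0 < R" "2 \<le> R powr (1 - a)" "C * c' / c < R powr (?f - ?e)"
      unfolding eventually_at_top_linorder by auto
    have "R powr a * 2 \<le> R powr a * R powr (1 - a)"
      using R by (intro mult_left_mono) auto
    also have "\<dots> = R" using R by (simp flip: powr_add)
    finally have "R powr a \<le> R / 2" by simp
    note F = fam[OF R(1) this, unfolded Let_def]
    have "ennreal (c * R powr ?f) \<le> ennreal C * ennreal (c' * R powr ?e)"
      using F emb mult_left_mono[of _ "ennreal (c' * R powr ?e)" "ennreal C"]
      by (meson order_trans zero_le)
    also have "\<dots> = ennreal (C * c' * R powr ?e)"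
      using C c by (simp add: ennreal_mult mult.assoc)
    finally have "c * R powr ?f \<le> C * c' * R powr ?e"
      using C c by (subst (asm) ennreal_le_iff) auto
    moreover have "R powr ?f = R powr (?f - ?e) * R powr ?e"
      by (simp flip: powr_add)
    ultimately have "c * R powr (?f - ?e) \<le> C * c'"
      using R(1) by (simp flip: mult.assoc)
    then show False using R(3) c by (simp add: field_simps)
  qed
qed

end
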